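(* Let $G^\phi$ be a $2$-connected mixed plane graph and let $C_{n_1},\dots,C_{n_k}$ be the distinct face cycles in $G$, each considered in clockwise direction, where $n_r$ is the order of $C_{n_r}$ for each $r\in\{1,\dots,k\}$. Then $$|[G^\phi]|=\sum_{X\in\Gamma_G(y)}\ \prod_{\substack{p,q=1\\ p\le q,\ n_{pq}\ne 0}}^{k}\alpha_{x_{pq}}(n_{pq}),$$ where $X=[x_{pq}]$, $y=(y_1,\dots,y_k)$ and $y_p=\zeta_{G^\phi}(C_{n_p})$ for each $p\in\{1,\dots,k\}$.
   Context: Mixed graphs: a partial orientation $\phi$ of a finite simple undirected graph $G$ chooses a subset $S\subseteq E(G)$ and one of the two directions for each edge in $S$, giving the mixed graph $G^\phi$. Its Hermitian adjacency matrix $H(G^\phi)=[h_{uv}]$ has $h_{uv}=1$ if $uv$ is an undirected edge, $\mathbf{i}$ if the edge is directed from $u$ to $v$, $-\mathbf{i}$ if directed from $v$ to $u$, and $0$ otherwise ($\mathbf{i}=\sqrt{-1}$). The gain of a directed cycle $C=u_1\ldots u_ku_1$ in $G$ is $\zeta_{G^\phi}(C)=h_{u_1u_2}\cdots h_{u_ku_1}$. $G^\phi$ and $G^\gamma$ are switching equivalent if $D^{-1}H(G^\phi)D=H(G^\gamma)$ for some diagonal matrix $D$ with diagonal entries in $\{\pm1,\pm\mathbf{i}\}$; $[G^\phi]$ is the set of all mixed graphs $G^\gamma$ on the same underlying graph $G$ switching equivalent to $G^\phi$. A mixed plane graph is a mixed graph whose underlying graph $G$ is a plane graph (embedded in the plane);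 it is $2$-connected if $G$ is. A face cycle of $G$ is a cycle whose edge set is the boundary of an inner (bounded) face of $G$. For $p\ne q$, $E_{pq}=E(C_{n_p})\cap E(C_{n_q})$, and $E_{pp}$ is the set of edges that lie on the face cycle $C_{n_p}$ and on no other face cycle; $n_{pq}=|E_{pq}|$. For $y\in\{\pm1,\pm\mathbf{i}\}^k$, $\Gamma_G(y)$ is the set of all $k\times k$ matrices $X=[x_{pq}]$ such that: (1) $x_{pq}=0$ if $n_{pq}=0$, $x_{pq}\in\{1,\mathbf{i},-\mathbf{i}\}$ if $n_{pq}=1$, and $x_{pq}\in\{1,-1,\mathbf{i},-\mathbf{i}\}$ if $n_{pq}>1$; (2) $\prod_{q:\,n_{pq}\neq0}x_{pq}=y_p$ for each $p\in\{1,\dots,k\}$; (3) $x_{pq}=\overline{x_{qp}}$ for $p\ne q$. For $n\ge1$ and $x\in\{\pm1,\pm\mathbf{i}\}$, $\alpha_x(n)$ is the number of $(z_1,\dots,z_n)\in\{1,\mathbf{i},-\mathbf{i}\}^n$ with $z_1\cdots z_n=x$. *)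

theory Defs
  imports "HOL-Complex_Analysis.Complex_Analysis" "Jordan_Normal_Form.Matrix"
begin

no_notation Matrix.vec_index (infixl \<open>$\<close> 100)
no_notation Matrix.scalar_prod (infix \<open>\<bullet>\<close> 70)

text \<open>Graphs have the finite type \<^typ>\<open>'v\<close> as vertex set and are given by their edge set,
  a set of two-element sets of vertices.\<close>

definition simple_graph :: "'v::finite set set \<Rightarrow> bool" where
  "simple_graph E \<longleftrightarrow> (\<forall>e\<in>E. card e = 2)"

definition induced_connected :: "'v::finite set set \<Rightarrow> 'v set \<Rightarrow> bool" where
  "induced_connected E W \<longleftrightarrow> W \<noteq> {} \<and>
     (\<forall>u\<in>W. \<forall>v\<in>W. (u, v) \<in> {(a, b). a \<in> W \<and> b \<in> W \<and> {a, b} \<in> E}\<^sup>*)"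

definition two_connected :: "'v::finite set set \<Rightarrow> bool" where
  "two_connected E \<longleftrightarrow> CARD('v) > 2 \<and>
     (\<forall>X :: 'v set. card X < 2 \<longrightarrow> induced_connected E (UNIV - X))"

text \<open>A cycle, with a direction of traversal, is the list of its vertices; \<open>c\<close> and its rotations
  are the same directed cycle, and all notions below are invariant under rotation.\<close>

definition is_cycle :: "'v::finite set set \<Rightarrow> 'v list \<Rightarrow> bool" where
  "is_cycle E c \<longleftrightarrow> length c \<ge> 3 \<and> distinct c \<and>
     (\<forall>i<length c. {c ! i, c ! (Suc i mod length c)} \<in> E)"

definition cycle_edges :: "'v list \<Rightarrow> 'v set set" where
  "cycle_edges c = {{c ! i, c ! (Suc i mod length c)} | i. i < length c}"


section \<open>Mixed graphs\<close>

text \<open>A partial orientation is the set of its directed edges: \<open>(u, v)\<close> in it means that the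
  edge \<open>{u, v}\<close> is directed from \<open>u\<close> to \<open>v\<close>. Edges with no direction in it stay undirected.\<close>

definition partial_orientation :: "'v::finite set set \<Rightarrow> ('v \<times> 'v) set \<Rightarrow> bool" where
  "partial_orientation E \<phi> \<longleftrightarrow> (\<forall>u v. (u, v) \<in> \<phi> \<longrightarrow> {u, v} \<in> E \<and> (v, u) \<notin> \<phi>)"

definition hermitian_adjacency ::
    "'v::finite set set \<Rightarrow> ('v \<times> 'v) set \<Rightarrow> complex ^ 'v ^ 'v" where
  "hermitian_adjacency E \<phi> = (\<chi> u v.
     if {u, v} \<notin> E then 0
     else if (u, v) \<in> \<phi> then \<i>
     else if (v, u) \<in> \<phi> then - \<i>
     else 1)"

definition gain :: "'v::finite set set \<Rightarrow> ('v \<times> 'v) set \<Rightarrow> 'v list \<Rightarrow> complex" where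
  "gain E \<phi> c =
     (\<Prod>i<length c. hermitian_adjacency E \<phi> $ (c ! i) $ (c ! (Suc i mod length c)))"

definition switching_equivalent ::
    "'v::finite set set \<Rightarrow> ('v \<times> 'v) set \<Rightarrow> ('v \<times> 'v) set \<Rightarrow> bool" where
  "switching_equivalent E \<phi> \<psi> \<longleftrightarrow> (\<exists>D :: complex ^ 'v ^ 'v.
     (\<forall>u v. u \<noteq> v \<longrightarrow> D $ u $ v = 0) \<and>
     (\<forall>u. D $ u $ u \<in> {1, -1, \<i>, -\<i>}) \<and>
     matrix_inv D ** hermitian_adjacency E \<phi> ** D = hermitian_adjacency E \<psi>)"

definition switching_class ::
    "'v::finite set set \<Rightarrow> ('v \<times> 'v) set \<Rightarrow> ('v \<times> 'v) set set" where
  "switching_class E \<phi> = {\<psi>. partial_orientation E \<psi> \<and> switching_equivalent E \<phi> \<psi>}"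


section \<open>Plane graphs and face cycles\<close>

text \<open>A vertex \<open>v\<close> is drawn at the point \<open>pos v\<close> and an edge \<open>e\<close> along the arc \<open>crv e\<close>, whose
  direction of parametrization is arbitrary. An arc contains no vertices other than its ends,
  and two distinct arcs meet only in common ends.\<close>

definition plane_embedding ::
    "'v::finite set set \<Rightarrow> ('v \<Rightarrow> complex) \<Rightarrow> ('v set \<Rightarrow> real \<Rightarrow> complex) \<Rightarrow> bool" where
  "plane_embedding E pos crv \<longleftrightarrow>
     inj pos \<and>
     (\<forall>e\<in>E. arc (crv e) \<and> {pathstart (crv e), pathfinish (crv e)} = pos ` e) \<and>
     (\<forall>e\<in>E. \<forall>v. pos v \<in> path_image (crv e) \<longrightarrow> v \<in> e) \<and>
     (\<forall>e\<in>E. \<forall>e'\<in>E. e \<noteq> e' \<longrightarrow>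
        path_image (crv e) \<inter> path_image (crv e') \<subseteq> pos ` (e \<inter> e'))"

definition inner_faces ::
    "'v::finite set set \<Rightarrow> ('v \<Rightarrow> complex) \<Rightarrow> ('v set \<Rightarrow> real \<Rightarrow> complex) \<Rightarrow> complex set set" where
  "inner_faces E pos crv =
     {F \<in> components (- (range pos \<union> (\<Union>e\<in>E. path_image (crv e)))). bounded F}"

definition boundary_edges ::
    "'v::finite set set \<Rightarrow> ('v set \<Rightarrow> real \<Rightarrow> complex) \<Rightarrow> complex set \<Rightarrow> 'v set set" where
  "boundary_edges E crv F = {e \<in> E. path_image (crv e) \<subseteq> frontier F}"

definition face_cycle ::
    "'v::finite set set \<Rightarrow> ('v \<Rightarrow> complex) \<Rightarrow> ('v set \<Rightarrow> real \<Rightarrow> complex) \<Rightarrow> 'v list \<Rightarrow> bool" where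
  "face_cycle E pos crv c \<longleftrightarrow> is_cycle E c \<and>
     (\<exists>F\<in>inner_faces E pos crv. cycle_edges c = boundary_edges E crv F)"

definition edge_path ::
    "('v \<Rightarrow> complex) \<Rightarrow> ('v set \<Rightarrow> real \<Rightarrow> complex) \<Rightarrow> 'v \<Rightarrow> 'v \<Rightarrow> real \<Rightarrow> complex" where
  "edge_path pos crv u v =
     (if pathstart (crv {u, v}) = pos u then crv {u, v} else reversepath (crv {u, v}))"

text \<open>The curve drawn by a walk, given as the list of its vertices. The first two equations are
  junk values: they are not reached from a list with at least two vertices.\<close>

fun walk_path ::
    "('v \<Rightarrow> complex) \<Rightarrow> ('v set \<Rightarrow> real \<Rightarrow> complex) \<Rightarrow> 'v list \<Rightarrow> real \<Rightarrow> complex" where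
  "walk_path pos crv [] = (\<lambda>_. 0)"
| "walk_path pos crv [u] = (\<lambda>_. pos u)"
| "walk_path pos crv [u, v] = edge_path pos crv u v"
| "walk_path pos crv (u # v # w # ws) =
     edge_path pos crv u v +++ walk_path pos crv (v # w # ws)"

definition cycle_path ::
    "('v \<Rightarrow> complex) \<Rightarrow> ('v set \<Rightarrow> real \<Rightarrow> complex) \<Rightarrow> 'v list \<Rightarrow> real \<Rightarrow> complex" where
  "cycle_path pos crv c = walk_path pos crv (c @ [hd c])"

text \<open>A simple closed curve winds once around each point inside it, with winding number \<open>1\<close>
  if it is traversed counterclockwise and \<open>-1\<close> if it is traversed clockwise.\<close>

definition clockwise ::
    "('v \<Rightarrow> complex) \<Rightarrow> ('v set \<Rightarrow> real \<Rightarrow> complex) \<Rightarrow> 'v list \<Rightarrow> bool" where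
  "clockwise pos crv c \<longleftrightarrow>
     (\<forall>z \<in> inside (path_image (cycle_path pos crv c)). winding_number (cycle_path pos crv c) z = -1)"

text \<open>\<open>Cs\<close> lists every face cycle exactly once, in clockwise direction. Undirected cycles are
  compared by their edge sets.\<close>

definition clockwise_face_cycles ::
    "'v::finite set set \<Rightarrow> ('v \<Rightarrow> complex) \<Rightarrow> ('v set \<Rightarrow> real \<Rightarrow> complex) \<Rightarrow> 'v list list \<Rightarrow> bool" where
  "clockwise_face_cycles E pos crv Cs \<longleftrightarrow>
     (\<forall>c\<in>set Cs. face_cycle E pos crv c \<and> clockwise pos crv c) \<and>
     distinct (map cycle_edges Cs) \<and>
     (\<forall>c. face_cycle E pos crv c \<longrightarrow> cycle_edges c \<in> cycle_edges ` set Cs)"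


section \<open>The quantities in the counting formula\<close>

text \<open>Face cycles, and the rows and columns of the matrices, are indexed from \<open>0\<close> to \<open>k - 1\<close>.\<close>

definition shared_edges :: "'v list list \<Rightarrow> nat \<Rightarrow> nat \<Rightarrow> 'v set set" where
  "shared_edges Cs p q =
     (if p = q
      then cycle_edges (Cs ! p) - (\<Union>r\<in>{..<length Cs} - {p}. cycle_edges (Cs ! r))
      else cycle_edges (Cs ! p) \<inter> cycle_edges (Cs ! q))"

definition num_shared :: "'v list list \<Rightarrow> nat \<Rightarrow> nat \<Rightarrow> nat" where
  "num_shared Cs p q = card (shared_edges Cs p q)"

definition Gamma_set :: "'v list list \<Rightarrow> complex list \<Rightarrow> complex mat set" where
  "Gamma_set Cs y = {X \<in> carrier_mat (length Cs) (length Cs).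
     (\<forall>p<length Cs. \<forall>q<length Cs.
        (num_shared Cs p q = 0 \<longrightarrow> X $$ (p, q) = 0) \<and>
        (num_shared Cs p q = 1 \<longrightarrow> X $$ (p, q) \<in> {1, \<i>, -\<i>}) \<and>
        (num_shared Cs p q > 1 \<longrightarrow> X $$ (p, q) \<in> {1, -1, \<i>, -\<i>})) \<and>
     (\<forall>p<length Cs. (\<Prod>q | q < length Cs \<and> num_shared Cs p q \<noteq> 0. X $$ (p, q)) = y ! p) \<and>
     (\<forall>p<length Cs. \<forall>q<length Cs. p \<noteq> q \<longrightarrow> X $$ (p, q) = cnj (X $$ (q, p)))}"

definition alpha :: "complex \<Rightarrow> nat \<Rightarrow> nat" where
  "alpha x n = card {zs. length zs = n \<and> set zs \<subseteq> {1, \<i>, -\<i>} \<and> prod_list zs = x}"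

end

theory Submission
  imports Defs
begin

text \<open>
  Why the formula holds. Two facts about a two-connected plane graph carry the proof.

  First, the gains of the face cycles determine the switching class. Two orientations are switching
  equivalent exactly when the ratio \<open>w\<close> of their Hermitian weights along each edge is the quotient of
  the values at its ends of a function from the vertices to the fourth roots of unity
  (\<open>switching_equivalent_iff\<close>), and such a function exists as soon as \<open>w\<close> has
  product \<open>1\<close> around every cycle (\<open>potential_exists\<close>). Face cycles suffice for this. If something is
  drawn inside a cycle \<open>C\<close>, two-connectedness gives a path that crosses the inside of \<open>C\<close> between
  two of its vertices (\<open>ear_inside\<close>); the path splits \<open>C\<close> into two cycles with less inside them, and
  the weights along the path cancel (\<open>cycle_split\<close>). If nothing is drawn inside \<open>C\<close>, then \<open>C\<close>
  is a face cycle. So induction reduces every cycle to face cycles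
  (\<open>trivial_on_faces_trivial_on_cycles\<close>).

  Second, every edge lies on one or two face cycles, and the two clockwise traversals of an edge on two
  face cycles are opposite. An edge on no face cycle could be given the weight \<open>2\<close> without changing
  the product around any face cycle, but the edge lies on some cycle, whose product would then change
  (\<open>edge_on_face_cycle\<close>). If two clockwise face cycles contained the same arrow, compare their winding
  numbers: the contributions of the common edge cancel in the difference, which is therefore continuous
  at an interior point of that edge, yet takes the values \<open>-1\<close> and \<open>1\<close> arbitrarily close to that
  point, on the two faces (\<open>clockwise_face_cycles_arrows_disjoint\<close>). This needs the face of a face
  cycle to be the inside of its curve, for which it has to be excluded that a bounded face lies outside
  the cycle that bounds it. Janiszewski's theorem does this: two points separated by the drawing are
  separated by one of its cycles (\<open>separated_by_cycle\<close>), so every bounded face lies inside some cycle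
  and, descending through \<open>cycle_split\<close>, is the inside of one (\<open>inner_face_is_inside\<close>).

  The rest is counting. The sets \<open>shared_edges Cs p q\<close> with \<open>p \<le> q\<close> partition the edges. After
  the choice of one direction for each edge, an orientation is a labeling of the edges by \<open>1\<close>,
  \<open>\<i>\<close> and \<open>-\<i>\<close>. The products of the labels over the blocks of the partition form a matrix whose
  rows multiply to the gains of the face cycles (\<open>gain_face_matrix\<close>), so this matrix lies in
  \<open>Gamma_set\<close> exactly when the gains are the prescribed ones. The labelings with a given matrix are
  chosen block by block, in \<open>alpha\<close> many ways for each block (\<open>card_orientations_with_gains\<close>).
\<close>

section \<open>Walks and cycles as lists of arrows\<close>

text \<open>Weights and winding numbers depend on the direction in which an edge is traversed, so walks are
  handled through their arrows, the ordered pairs of consecutive vertices: \<open>steps\<close> for an open walk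
  and \<open>arrows\<close> for a closed one.\<close>

definition steps :: "'a list \<Rightarrow> ('a \<times> 'a) list" where
  "steps xs = zip xs (tl xs)"

definition arrows :: "'a list \<Rightarrow> ('a \<times> 'a) list" where
  "arrows c = zip c (rotate1 c)"

definition ends :: "'a \<times> 'a \<Rightarrow> 'a set" where
  "ends d = {fst d, snd d}"

lemma ends_pair [simp]: "ends (u, v) = {u, v}"
  by (simp add: ends_def)

lemma ends_swap [simp]: "ends (prod.swap d) = ends d"
  by (cases d) auto

lemma ends_eq_iff: "ends d = ends d' \<longleftrightarrow> d = d' \<or> d = prod.swap d'"
  by (cases d; cases d') (auto simp: doubleton_eq_iff)

lemma steps_simps [simp]:
  "steps [] = []" "steps [x] = []" "steps (x # y # zs) = (x, y) # steps (y # zs)"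
  by (simp_all add: steps_def)

text \<open>The junction vertex belongs to both parts. This is the form in which products of weights are
  split along a walk.\<close>

lemma steps_append: "steps (xs @ x # ys) = steps (xs @ [x]) @ steps (x # ys)"
proof (induction xs)
  case (Cons a xs)
  then show ?case by (cases xs) auto
qed auto

lemma steps_rev: "steps (rev xs) = rev (map prod.swap (steps xs))"
proof (induction xs)
  case (Cons a xs)
  then show ?case
    using steps_append[of "rev (tl xs)" "hd xs" "[a]"] by (cases xs) auto
qed auto

lemma Union_ends_steps: "length xs \<ge> 2 \<Longrightarrow> \<Union>(ends ` set (steps xs)) = set xs"
proof (induction xs rule: remdups_adj.induct)
  case (3 u v xs)
  then show ?case by (cases xs; cases "u = v") auto
qed auto

lemma map_fst_steps: "map fst (steps xs) = butlast xs"
  by (induction xs) (auto simp: steps_def map_fst_zip_take butlast_conv_take)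

lemma map_snd_steps: "map snd (steps xs) = tl xs"
  by (induction xs) (auto simp: steps_def map_snd_zip_take)

lemma step_in_set: "d \<in> set (steps xs) \<Longrightarrow> fst d \<in> set xs \<and> snd d \<in> set xs"
proof -
  assume "d \<in> set (steps xs)"
  then have "fst d \<in> set (butlast xs)" "snd d \<in> set (tl xs)"
    by (metis imageI list.set_map map_fst_steps map_snd_steps)+
  then show ?thesis by (cases xs) (auto dest: in_set_butlastD split: if_splits)
qed

lemma ends_steps_subset: "d \<in> set (steps xs) \<Longrightarrow> ends d \<subseteq> set xs"
  using step_in_set[of d xs] by (auto simp: ends_def)

lemma arrows_conv_steps: "c \<noteq> [] \<Longrightarrow> arrows c = steps (c @ [hd c])"
proof (cases c)
  case (Cons x xs)
  have "zip ((x # xs) @ [x]) ((xs @ [x]) @ []) = zip (x # xs) (xs @ [x]) @ zip [x] []"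
    by (rule zip_append) simp
  then show ?thesis by (simp add: Cons arrows_def steps_def)
qed simp

lemma arrows_split: "arrows (a # A @ b # B) = steps (a # A @ [b]) @ steps (b # B @ [a])"
  using steps_append[of "a # A" b "B @ [a]"] by (simp add: arrows_conv_steps)

lemma set_arrows_rotate: "set (arrows (xs @ ys)) = set (arrows (ys @ xs))"
  by (cases xs; cases ys) (auto simp: arrows_split)

lemma map_fst_arrows: "map fst (arrows c) = c"
  by (simp add: arrows_def)

lemma map_snd_arrows: "map snd (arrows c) = rotate1 c"
  by (simp add: arrows_def)

lemma distinct_arrows: "distinct c \<Longrightarrow> distinct (arrows c)"
  by (simp add: arrows_def distinct_zipI1)

lemma set_arrows: "set (arrows c) = (\<lambda>i. (c ! i, c ! (Suc i mod length c))) ` {..<length c}"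
  by (force simp: arrows_def set_zip nth_rotate1)

lemma arrow_snd_inj:
  assumes "distinct c" "(u, v) \<in> set (arrows c)" "(u', v) \<in> set (arrows c)"
  shows "u = u'"
proof -
  have "inj_on snd (set (arrows c))"
    using assms(1) by (metis distinct1_rotate distinct_map map_snd_arrows)
  then show ?thesis using assms(2,3) by (metis inj_onD fst_conv snd_conv)
qed

lemma arrows_cover:
  assumes "u \<in> set c"
  shows "\<exists>v. (u, v) \<in> set (arrows c)"
proof -
  have "u \<in> set (map fst (arrows c))" using assms by (simp add: map_fst_arrows)
  then show ?thesis by auto
qed

lemma arrow_in_set: "d \<in> set (arrows c) \<Longrightarrow> fst d \<in> set c \<and> snd d \<in> set c"
  by (metis imageI list.set_map map_fst_arrows map_snd_arrows set_rotate1)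

lemma cycle_edges_arrows: "cycle_edges c = ends ` set (arrows c)"
  by (auto simp: cycle_edges_def set_arrows image_image)

lemma cycle_edge_subset: "e \<in> cycle_edges c \<Longrightarrow> e \<subseteq> set c"
  using arrow_in_set by (fastforce simp: cycle_edges_arrows ends_def)

lemma is_cycle_arrows:
  "is_cycle E c \<longleftrightarrow> length c \<ge> 3 \<and> distinct c \<and> cycle_edges c \<subseteq> E"
  by (auto simp: is_cycle_def cycle_edges_def)

lemma gain_arrows:
  assumes "distinct c"
  shows "gain E \<phi> c = (\<Prod>(u, v)\<in>set (arrows c). hermitian_adjacency E \<phi> $ u $ v)"
proof -
  have "inj_on (\<lambda>i. (c ! i, c ! (Suc i mod length c))) {..<length c}"
    using assms by (auto simp: inj_on_def nth_eq_iff_index_eq)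
  then show ?thesis
    by (simp add: gain_def set_arrows prod.reindex)
qed

text \<open>Turning back would mean that two steps along the cycle return to the start, which needs a cycle
  of length at most two.\<close>

lemma arrow_not_reversed:
  assumes "distinct c" "length c \<ge> 3" "(u, v) \<in> set (arrows c)"
  shows "(v, u) \<notin> set (arrows c)"
proof
  let ?n = "length c"
  assume "(v, u) \<in> set (arrows c)"
  with assms(3) obtain i j where i: "i < ?n" "u = c ! i" "v = c ! (Suc i mod ?n)"
    and j: "j < ?n" "v = c ! j" "u = c ! (Suc j mod ?n)"
    by (auto simp: set_arrows)
  have n: "?n > 0" using assms(2) by linarith
  have "Suc i mod ?n = j" "Suc j mod ?n = i"
    using i j n assms(1) by (metis mod_less_divisor nth_eq_iff_index_eq)+
  then show False
    using assms(2) i(1) j(1) by (auto simp: mod_Suc split: if_splits)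
qed

lemma inj_on_ends_arrows:
  assumes "distinct c" "length c \<ge> 3"
  shows "inj_on ends (set (arrows c))"
  using arrow_not_reversed[OF assms] by (fastforce simp: inj_on_def ends_eq_iff)

text \<open>From an arrow \<open>(u, v)\<close> of both cycles the two cycles continue alike: the next edge of one is an
  edge of the other at \<open>v\<close>, and the other already reaches \<open>v\<close> from \<open>u\<close>. Going once around, all
  arrows agree.\<close>

lemma arrows_eq_of_common_arrow:
  assumes c: "distinct c" "length c \<ge> 3" and c': "distinct c'" "length c' \<ge> 3"
    and eq: "cycle_edges c = cycle_edges c'"
    and d: "d \<in> set (arrows c)" "d \<in> set (arrows c')"
  shows "set (arrows c) = set (arrows c')"
proof -
  let ?n = "length c" and ?a = "\<lambda>i. (c ! i, c ! (Suc i mod length c))"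
  have n: "?n > 0" using c(2) by linarith
  have step: "?a (Suc i mod ?n) \<in> set (arrows c')" if i: "i < ?n" "?a i \<in> set (arrows c')" for i
  proof -
    let ?u = "c ! i" and ?v = "c ! (Suc i mod ?n)" and ?w = "c ! (Suc (Suc i mod ?n) mod ?n)"
    have vw: "(?v, ?w) \<in> set (arrows c)" and uv: "(?u, ?v) \<in> set (arrows c)"
      using n i(1) by (auto simp: set_arrows)
    then have "{?v, ?w} \<in> ends ` set (arrows c')"
      using imageI[OF vw, of ends] eq unfolding cycle_edges_arrows by simp
    then obtain d' where d': "d' \<in> set (arrows c')" "ends d' = ends (?v, ?w)"
      by (metis ends_pair imageE)
    then consider "(?v, ?w) \<in> set (arrows c')" | "(?w, ?v) \<in> set (arrows c')"
      by (auto simp: ends_eq_iff simp del: ends_pair)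
    then show ?thesis
    proof cases
      case 2
      then have "?w = ?u" using arrow_snd_inj[OF c'(1)] i(2) by blast
      then show ?thesis using arrow_not_reversed[OF c uv] vw by simp
    qed
  qed
  obtain i0 where i0: "i0 < ?n" "d = ?a i0" using d(1) by (auto simp: set_arrows)
  \<comment> \<open>The common arrow propagates from position \<open>i0\<close> around the whole cycle.\<close>
  have all: "?a ((i0 + k) mod ?n) \<in> set (arrows c')" for k
  proof (induction k)
    case 0 then show ?case using d(2) i0 by simp
  next
    case (Suc k)
    from step[OF _ this] n show ?case by (simp add: mod_Suc_eq)
  qed
  have sub: "set (arrows c) \<subseteq> set (arrows c')"
  proof
    fix d' assume "d' \<in> set (arrows c)"
    then obtain j where j: "j < ?n" "d' = ?a j" by (auto simp: set_arrows)
    have "(i0 + (j + ?n - i0)) mod ?n = j" using i0(1) j(1) by simp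
    then show "d' \<in> set (arrows c')" using all[of "j + ?n - i0"] j(2) by simp
  qed
  have "set (arrows c') \<subseteq> set (arrows c)"
  proof
    fix d' assume d': "d' \<in> set (arrows c')"
    then obtain d1 where "d1 \<in> set (arrows c)" "ends d1 = ends d'"
      using eq unfolding cycle_edges_arrows by (metis imageE imageI)
    then show "d' \<in> set (arrows c)"
      using sub d' inj_on_ends_arrows[OF c'] by (metis inj_on_def subsetD)
  qed
  with sub show ?thesis by blast
qed

text \<open>Face cycles are identified by their edges, while gains depend on the arrows. This is the bridge:
  the edges fix a cycle up to rotation and reversal.\<close>

lemma arrows_eq_or_reversed:
  assumes c: "distinct c" "length c \<ge> 3" and c': "distinct c'" "length c' \<ge> 3"
    and eq: "cycle_edges c = cycle_edges c'"
  shows "set (arrows c) = set (arrows c') \<or> set (arrows c) = prod.swap ` set (arrows c')"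
proof (cases "set (arrows c) \<inter> set (arrows c') = {}")
  case False
  then show ?thesis using arrows_eq_of_common_arrow[OF assms] by blast
next
  case True
  have *: "prod.swap d \<in> set (arrows b)"
    if "cycle_edges a = cycle_edges b" "set (arrows a) \<inter> set (arrows b) = {}" "d \<in> set (arrows a)"
    for a b :: "'a list" and d
  proof -
    have "ends d \<in> ends ` set (arrows b)" using that by (auto simp: cycle_edges_arrows)
    then obtain d' where "d' \<in> set (arrows b)" "ends d = ends d'" by auto
    then show ?thesis using that by (auto simp: ends_eq_iff)
  qed
  have "prod.swap ` set (arrows c') \<subseteq> set (arrows c)"
    using *[of c' c] eq True by (metis Int_commute image_subsetI)
  moreover have "set (arrows c) \<subseteq> prod.swap ` set (arrows c')"
    using *[of c c'] eq True by (metis image_eqI subsetI swap_swap)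
  ultimately show ?thesis by blast
qed

definition simple_walk :: "'v set set \<Rightarrow> 'v \<Rightarrow> 'v \<Rightarrow> 'v list \<Rightarrow> bool" where
  "simple_walk E u v xs \<longleftrightarrow>
     xs \<noteq> [] \<and> hd xs = u \<and> last xs = v \<and> distinct xs \<and> ends ` set (steps xs) \<subseteq> E"

lemma simple_walk_mono: "simple_walk E u v xs \<Longrightarrow> E \<subseteq> E' \<Longrightarrow> simple_walk E' u v xs"
  by (auto simp: simple_walk_def)

text \<open>A walk that returns to one of its vertices is cut off there, so that vertices never repeat.\<close>

lemma rtrancl_simple_walk:
  assumes "(u, v) \<in> {(a, b). a \<in> W \<and> b \<in> W \<and> {a, b} \<in> E}\<^sup>*" "u \<in> W"
  shows "\<exists>xs. simple_walk E u v xs \<and> set xs \<subseteq> W"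
  using assms(1)
proof (induction rule: rtrancl_induct)
  case base
  then show ?case using assms(2) by (intro exI[of _ "[u]"]) (simp add: simple_walk_def)
next
  case (step y z)
  then obtain xs where xs: "simple_walk E u y xs" "set xs \<subseteq> W" by blast
  show ?case
  proof (cases "z \<in> set xs")
    case True
    then obtain ys zs where sp: "xs = ys @ z # zs" by (meson split_list)
    have "simple_walk E u z (ys @ [z])"
      using xs(1) unfolding sp simple_walk_def
      by (subst (asm) steps_append) (auto simp: hd_append)
    then show ?thesis using xs(2) sp by (intro exI[of _ "ys @ [z]"]) auto
  next
    case False
    obtain ws where ws: "xs = ws @ [y]"
      using xs(1) by (metis append_butlast_last_id simple_walk_def)
    have "steps (xs @ [z]) = steps xs @ [(y, z)]"
      using steps_append[of ws y "[z]"] by (simp add: ws)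
    then have "simple_walk E u z (xs @ [z])"
      using xs(1) step(2) False by (auto simp: simple_walk_def hd_append)
    then show ?thesis using xs(2) step(2) by (intro exI[of _ "xs @ [z]"]) auto
  qed
qed

lemma closed_walk_cycle:
  assumes "simple_walk E u v xs" "{u, v} \<in> E" "length xs \<ge> 3"
  shows "is_cycle E xs" "arrows xs = steps xs @ [(v, u)]"
proof -
  obtain ws where ws: "xs = ws @ [v]"
    using assms(1) by (metis append_butlast_last_id simple_walk_def)
  have hd: "hd (ws @ [v]) = u" using assms(1) ws by (simp add: simple_walk_def)
  show *: "arrows xs = steps xs @ [(v, u)]"
    using steps_append[of ws v "[u]"] by (simp add: arrows_conv_steps ws hd)
  show "is_cycle E xs"
    using assms unfolding is_cycle_arrows cycle_edges_arrows *
    by (auto simp: simple_walk_def insert_commute)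
qed

lemma simple_graph_edge: "simple_graph E \<Longrightarrow> {u, v} \<in> E \<Longrightarrow> u \<noteq> v"
  by (force simp: simple_graph_def)

section \<open>Two-connected graphs\<close>

lemma two_connected_avoid:
  assumes "two_connected E" "card X < 2" "u \<notin> X" "v \<notin> X"
  shows "(u, v) \<in> {(a, b). a \<in> - X \<and> b \<in> - X \<and> {a, b} \<in> E}\<^sup>*"
  using assms unfolding two_connected_def induced_connected_def Compl_eq_Diff_UNIV by blast

lemma two_connected_other_neighbour:
  fixes E :: "'v::finite set set"
  assumes "two_connected E" "u \<noteq> v"
  shows "\<exists>s. s \<noteq> u \<and> {v, s} \<in> E"
proof -
  have "card {u, v} < CARD('v)" using assms by (simp add: two_connected_def)
  then have "{u, v} \<noteq> UNIV" by (metis less_irrefl)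
  then obtain t where t: "t \<noteq> u" "t \<noteq> v" by blast
  have "(v, t) \<in> {(a, b). a \<in> - {u} \<and> b \<in> - {u} \<and> {a, b} \<in> E}\<^sup>*"
    using t assms by (intro two_connected_avoid) auto
  then show ?thesis
    by (cases rule: converse_rtranclE) (use t in auto)
qed

text \<open>Let \<open>s\<close> be another neighbour of \<open>v\<close>. A path from \<open>s\<close> to \<open>u\<close> that avoids \<open>v\<close>
  closes up through \<open>v\<close> to a cycle that uses the edge.\<close>

lemma edge_on_cycle:
  fixes E :: "'v::finite set set"
  assumes "simple_graph E" "two_connected E" "{u, v} \<in> E"
  shows "\<exists>c. is_cycle E c \<and> (u, v) \<in> set (arrows c)"
proof -
  have uv: "u \<noteq> v" using assms(1,3) by (rule simple_graph_edge)
  obtain s where s: "s \<noteq> u" "{v, s} \<in> E"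
    using two_connected_other_neighbour[OF assms(2) uv] by blast
  have sv: "s \<noteq> v" using simple_graph_edge[OF assms(1) s(2)] by blast
  have "(s, u) \<in> {(a, b). a \<in> - {v} \<and> b \<in> - {v} \<and> {a, b} \<in> E}\<^sup>*"
    using uv sv assms by (intro two_connected_avoid) auto
  then obtain xs where xs: "simple_walk E s u xs" "set xs \<subseteq> - {v}"
    using rtrancl_simple_walk[of s u "- {v}" E] sv by blast
  then obtain y ys where ys: "xs = s # y # ys"
    using s(1) by (cases xs rule: remdups_adj.cases) (auto simp: simple_walk_def)
  have w: "simple_walk E v u (v # xs)"
    using xs s(2) by (auto simp: simple_walk_def ys)
  have "is_cycle E (v # xs)" "arrows (v # xs) = steps (v # xs) @ [(u, v)]"
    using closed_walk_cycle[OF w] assms(3) ys by (auto simp: insert_commute)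
  then show ?thesis by (intro exI[of _ "v # xs"]) auto
qed

text \<open>The component \<open>K\<close> of \<open>x\<close> outside \<open>S\<close> has at least two neighbours in \<open>S\<close>, as a single
  one would separate \<open>K\<close> from the rest of \<open>S\<close>. Two such neighbours are joined by a path through
  \<open>K\<close>. The last conjunct records that the path stays in \<open>K\<close>; when \<open>S\<close> is the vertex set of a
  cycle, this keeps the path on one side of the cycle.\<close>

lemma ear_exists:
  fixes E :: "'v::finite set set"
  assumes "two_connected E" "card S \<ge> 2" "x \<notin> S"
  shows "\<exists>a b P. a \<in> S \<and> b \<in> S \<and> a \<noteq> b \<and> P \<noteq> [] \<and> set P \<inter> S = {} \<and> simple_walk E a b (a # P @ [b]) \<and>
     (\<forall>p\<in>set P. (x, p) \<in> {(a, b). a \<in> - S \<and> b \<in> - S \<and> {a, b} \<in> E}\<^sup>*)"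
proof -
  define R where "R = {(a, b). a \<in> - S \<and> b \<in> - S \<and> {a, b} \<in> E}"
  define K where "K = {y. (x, y) \<in> R\<^sup>*}"
  define N where "N = {a \<in> S. \<exists>u\<in>K. {a, u} \<in> E}"
  have KS: "K \<inter> S = {}"
  proof -
    have "y \<notin> S" if "(x, y) \<in> R\<^sup>*" for y
      using that by (cases rule: rtranclE) (use assms(3) in \<open>auto simp: R_def\<close>)
    then show ?thesis by (auto simp: K_def)
  qed
  have "card N \<ge> 2"
  proof (rule ccontr)
    assume "\<not> ?thesis"
    then have N: "card N < 2" by simp
    have "N \<subseteq> S" by (auto simp: N_def)
    with N assms(2) have "N \<noteq> S" by auto
    with \<open>N \<subseteq> S\<close> obtain s where s: "s \<in> S" "s \<notin> N" by blast
    have "(x, s) \<in> {(a, b). a \<in> - N \<and> b \<in> - N \<and> {a, b} \<in> E}\<^sup>*"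
      using assms(1) N \<open>N \<subseteq> S\<close> s assms(3) by (intro two_connected_avoid) auto
    then have "s \<in> K"
    proof (induction rule: rtrancl_induct)
      case base then show ?case by (simp add: K_def)
    next
      case (step y z)
      have "z \<notin> S" using step by (auto simp: N_def insert_commute)
      then have "(y, z) \<in> R" using step KS by (auto simp: R_def)
      then show ?case using step(3) by (auto simp: K_def)
    qed
    then show False using KS s by blast
  qed
  then obtain a b where ab: "a \<in> N" "b \<in> N" "a \<noteq> b"
    by (metis One_nat_def Suc_1 card_le_Suc0_iff_eq finite not_less_eq_eq)
  then obtain u v where u: "u \<in> K" "{a, u} \<in> E" and v: "v \<in> K" "{b, v} \<in> E"
    by (auto simp: N_def)
  define R' where "R' = {(a, b). a \<in> K \<and> b \<in> K \<and> {a, b} \<in> E}"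
  have symR: "sym R" by (auto simp: R_def sym_def insert_commute)
  have "(u, v) \<in> R\<^sup>*"
    using u(1) v(1) sym_rtrancl[OF symR] unfolding K_def sym_def by (meson mem_Collect_eq rtrancl_trans)
  then have "(u, v) \<in> R'\<^sup>*"
  proof (induction rule: rtrancl_induct)
    case (step y z)
    have "y \<in> K" using u(1) step(1) by (auto simp: K_def)
    moreover from this have "z \<in> K" using step(2) by (auto simp: K_def)
    ultimately have "(y, z) \<in> R'" using step(2) by (auto simp: R'_def R_def)
    then show ?case using step(3) by auto
  qed auto
  then obtain P where P: "simple_walk E u v P" "set P \<subseteq> K"
    using rtrancl_simple_walk[of u v K E] u(1) by (auto simp: R'_def)
  then obtain p ps where p: "P = p # ps" by (cases P) (auto simp: simple_walk_def)
  obtain qs where qs: "P = qs @ [v]" using P(1) by (metis append_butlast_last_id simple_walk_def)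
  have "steps (P @ [b]) = steps P @ [(v, b)]"
    using steps_append[of qs v "[b]"] by (simp add: qs)
  moreover have "steps (a # P @ [b]) = (a, u) # steps (P @ [b])"
    using P(1) by (simp add: p simple_walk_def)
  ultimately have "simple_walk E a b (a # P @ [b])"
    using P ab u v KS by (auto simp: simple_walk_def N_def insert_commute)
  moreover have "set P \<inter> S = {}" using P(2) KS by auto
  moreover have "a \<in> S" "b \<in> S" using ab by (auto simp: N_def)
  moreover have "\<forall>p\<in>set P. (x, p) \<in> R\<^sup>*" using P(2) by (auto simp: K_def)
  ultimately show ?thesis using ab(3) p unfolding R_def by blast
qed

lemma induced_connected_insert:
  assumes "induced_connected F S" "u \<in> S" "F \<subseteq> F'" "{u, v} \<in> F'"
  shows "induced_connected F' (insert v S)"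
proof -
  let ?R = "\<lambda>F S. {(a, b). a \<in> S \<and> b \<in> S \<and> {a, b} \<in> F}"
  let ?R' = "?R F' (insert v S)"
  have mono: "(?R F S)\<^sup>* \<subseteq> ?R'\<^sup>*" using assms(3) by (intro rtrancl_mono) auto
  have old: "(a, b) \<in> ?R'\<^sup>*" if "a \<in> S" "b \<in> S" for a b
    using assms(1) that mono unfolding induced_connected_def by blast
  have uv: "(u, v) \<in> ?R'" "(v, u) \<in> ?R'" using assms(2,4) by (auto simp: insert_commute)
  have "(a, u) \<in> ?R'\<^sup>*" "(u, a) \<in> ?R'\<^sup>*" if "a \<in> insert v S" for a
    using old assms(2) uv that by (cases "a = v"; blast)+
  then have "(a, b) \<in> ?R'\<^sup>*" if "a \<in> insert v S" "b \<in> insert v S" for a b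
    using that by (meson rtrancl_trans)
  then show ?thesis unfolding induced_connected_def by blast
qed

lemma two_connected_crossing_edge:
  assumes "two_connected E" "u \<in> S" "v \<notin> S"
  shows "\<exists>a\<in>S. \<exists>b. b \<notin> S \<and> {a, b} \<in> E"
proof (rule ccontr)
  assume none: "\<not> ?thesis"
  have "(u, v) \<in> {(a, b). a \<in> - {} \<and> b \<in> - {} \<and> {a, b} \<in> E}\<^sup>*"
    by (rule two_connected_avoid[OF assms(1)]) auto
  then have "v \<in> S"
    by (induction rule: rtrancl_induct) (use assms(2) none in auto)
  then show False using assms(3) by simp
qed

section \<open>Walks and cycles as curves\<close>

text \<open>Throughout, two drawn edges can meet only in common vertices. From this it follows that walks are
  drawn as arcs and cycles as simple closed curves, so that the Jordan curve theorem applies to them.\<close>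

locale plane_graph =
  fixes E :: "'v::finite set set" and pos :: "'v \<Rightarrow> complex" and crv :: "'v set \<Rightarrow> real \<Rightarrow> complex"
  assumes simple: "simple_graph E" and embedding: "plane_embedding E pos crv"
begin

definition edges_image :: "'v set set \<Rightarrow> complex set" where
  "edges_image F = (\<Union>e\<in>F. path_image (crv e))"

abbreviation curve_of :: "'v list \<Rightarrow> complex set" where
  "curve_of c \<equiv> edges_image (cycle_edges c)"

abbreviation drawing :: "complex set" where
  "drawing \<equiv> range pos \<union> edges_image E"

lemma inj_pos: "inj pos"
  using embedding by (simp add: plane_embedding_def)

lemma arc_crv: "e \<in> E \<Longrightarrow> arc (crv e)"
  using embedding by (simp add: plane_embedding_def)

lemma crv_ends: "e \<in> E \<Longrightarrow> {pathstart (crv e), pathfinish (crv e)} = pos ` e"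
  using embedding by (simp add: plane_embedding_def)

lemma vertex_on_edge: "e \<in> E \<Longrightarrow> pos v \<in> path_image (crv e) \<longleftrightarrow> v \<in> e"
proof
  assume e: "e \<in> E"
  show "v \<in> e" if "pos v \<in> path_image (crv e)"
    using embedding e that by (auto simp: plane_embedding_def)
  show "pos v \<in> path_image (crv e)" if "v \<in> e"
  proof -
    have "pos v \<in> {pathstart (crv e), pathfinish (crv e)}" using crv_ends[OF e] that by auto
    then show ?thesis by auto
  qed
qed

lemma edges_meet:
  assumes "e \<in> E" "e' \<in> E" "e \<noteq> e'"
  shows "path_image (crv e) \<inter> path_image (crv e') = pos ` (e \<inter> e')"
proof
  show "path_image (crv e) \<inter> path_image (crv e') \<subseteq> pos ` (e \<inter> e')"
    using assms embedding by (simp add: plane_embedding_def)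
  show "pos ` (e \<inter> e') \<subseteq> path_image (crv e) \<inter> path_image (crv e')"
    using vertex_on_edge assms(1,2) by blast
qed

lemma edge_distinct: "{u, v} \<in> E \<Longrightarrow> u \<noteq> v"
  using simple by (rule simple_graph_edge)

lemma edge_pair:
  assumes "e \<in> E" obtains u v where "e = {u, v}" "u \<noteq> v"
  using assms simple by (auto simp: simple_graph_def card_2_iff)

lemma edges_image_mono: "F \<subseteq> F' \<Longrightarrow> edges_image F \<subseteq> edges_image F'"
  by (auto simp: edges_image_def)

lemma edges_image_Un: "edges_image (F \<union> F') = edges_image F \<union> edges_image F'"
  by (auto simp: edges_image_def)

lemma edges_image_insert: "edges_image (insert e F) = path_image (crv e) \<union> edges_image F"
  by (auto simp: edges_image_def)

lemma edges_image_empty [simp]: "edges_image {} = {}"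
  by (simp add: edges_image_def)

lemma vertex_on_edges: "F \<subseteq> E \<Longrightarrow> pos v \<in> edges_image F \<longleftrightarrow> v \<in> \<Union>F"
  using vertex_on_edge by (auto simp: edges_image_def)

lemma edges_images_meet:
  assumes "F \<subseteq> E" "F' \<subseteq> E" "F \<inter> F' = {}"
  shows "edges_image F \<inter> edges_image F' = pos ` (\<Union>F \<inter> \<Union>F')"
proof -
  have "x \<in> pos ` (\<Union>F \<inter> \<Union>F')" if "e \<in> F" "e' \<in> F'" "x \<in> path_image (crv e)" "x \<in> path_image (crv e')"
    for x e e'
  proof -
    have "e \<noteq> e'" "e \<in> E" "e' \<in> E" using assms that by auto
    from edges_meet[OF this(2,3,1)] that show ?thesis by blast
  qed
  moreover have "pos v \<in> edges_image F \<inter> edges_image F'" if "v \<in> \<Union>F \<inter> \<Union>F'" for v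
    using vertex_on_edges assms that by blast
  ultimately show ?thesis by (fastforce simp: edges_image_def)
qed

lemma compact_edges_image: "F \<subseteq> E \<Longrightarrow> compact (edges_image F)"
  unfolding edges_image_def
  by (intro compact_UN) (use arc_crv compact_arc_image in auto)

lemma edge_path_props:
  assumes "{u, v} \<in> E"
  shows "arc (edge_path pos crv u v)" "pathstart (edge_path pos crv u v) = pos u"
    "pathfinish (edge_path pos crv u v) = pos v"
    "path_image (edge_path pos crv u v) = path_image (crv {u, v})"
proof -
  have "pos u \<noteq> pos v" using edge_distinct[OF assms] inj_pos by (auto dest: injD)
  then show "arc (edge_path pos crv u v)" "pathstart (edge_path pos crv u v) = pos u"
    "pathfinish (edge_path pos crv u v) = pos v"
    "path_image (edge_path pos crv u v) = path_image (crv {u, v})"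
    using arc_crv[OF assms] crv_ends[OF assms]
    by (auto simp: edge_path_def arc_reversepath doubleton_eq_iff)
qed

lemma walk_path_curve:
  assumes "ends ` set (steps xs) \<subseteq> E" "length xs \<ge> 2"
  shows "path (walk_path pos crv xs) \<and> pathstart (walk_path pos crv xs) = pos (hd xs) \<and>
    pathfinish (walk_path pos crv xs) = pos (last xs) \<and>
    path_image (walk_path pos crv xs) = edges_image (ends ` set (steps xs))"
  using assms
proof (induction xs rule: remdups_adj.induct)
  case (3 u v xs)
  then have uv: "{u, v} \<in> E" by auto
  note ep = edge_path_props[OF uv] arc_imp_path[OF edge_path_props(1)[OF uv]]
  show ?case
  proof (cases xs)
    case Nil
    then show ?thesis using ep by (simp add: edges_image_insert)
  next
    case (Cons w ws)
    from 3 have IH: "path (walk_path pos crv (v # xs))"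
      "pathstart (walk_path pos crv (v # xs)) = pos v"
      "pathfinish (walk_path pos crv (v # xs)) = pos (last (v # xs))"
      "path_image (walk_path pos crv (v # xs)) = edges_image (ends ` set (steps (v # xs)))"
      by (cases "u = v"; simp add: Cons)+
    then show ?thesis using ep
      by (simp add: Cons path_image_join edges_image_insert)
  qed
qed auto

lemma walk_path_arc:
  assumes "ends ` set (steps xs) \<subseteq> E" "length xs \<ge> 2" "distinct xs"
  shows "arc (walk_path pos crv xs)"
  using assms
proof (induction xs rule: remdups_adj.induct)
  case (3 u v xs)
  then have uv: "{u, v} \<in> E" and u: "u \<noteq> v" "u \<notin> set xs" by auto
  note ep = edge_path_props[OF uv]
  show ?case
  proof (cases xs)
    case Nil
    then show ?thesis using ep by simp
  next
    case (Cons w ws)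
    have sub: "ends ` set (steps (v # xs)) \<subseteq> E" using 3 by auto
    have arc: "arc (walk_path pos crv (v # xs))"
      using 3 u by (simp add: Cons)
    note wp = walk_path_curve[OF sub]
    have dis: "{{u, v}} \<inter> ends ` set (steps (v # xs)) = {}"
      using u ends_steps_subset[of _ "v # xs"] by fastforce
    have "edges_image {{u, v}} \<inter> edges_image (ends ` set (steps (v # xs))) \<subseteq> {pos v}"
      using edges_images_meet[OF _ sub dis] uv u ends_steps_subset[of _ "v # xs"] by auto
    then have "arc (edge_path pos crv u v +++ walk_path pos crv (v # xs))"
      using ep arc wp by (intro arc_join) (simp_all add: Cons edges_image_insert)
    then show ?thesis by (simp add: Cons)
  qed
qed auto

lemma closed_steps: "is_cycle E c \<Longrightarrow> ends ` set (steps (c @ [hd c])) = cycle_edges c"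
  by (cases "c = []") (simp_all add: is_cycle_arrows cycle_edges_arrows arrows_conv_steps)

lemma cycle_path_simple:
  assumes c: "is_cycle E c"
  shows "simple_path (cycle_path pos crv c)"
    and "pathfinish (cycle_path pos crv c) = pathstart (cycle_path pos crv c)"
    and "path_image (cycle_path pos crv c) = curve_of c"
proof -
  obtain u v w ws where cc: "c = u # v # w # ws"
    using c by (cases c rule: remdups_adj.cases; cases "tl (tl c)") (auto simp: is_cycle_arrows)
  have d: "distinct c" using c by (simp add: is_cycle_arrows)
  have sub: "ends ` set (steps (c @ [hd c])) \<subseteq> E"
    using c closed_steps by (simp add: is_cycle_arrows)
  let ?q = "v # w # ws @ [u]"
  have uv: "{u, v} \<in> E" and sub': "ends ` set (steps ?q) \<subseteq> E"
    using sub by (auto simp: cc)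
  note wp = walk_path_curve[OF sub'] and wa = walk_path_arc[OF sub'] and ep = edge_path_props[OF uv]
  have cp: "cycle_path pos crv c = edge_path pos crv u v +++ walk_path pos crv ?q"
    by (simp add: cycle_path_def cc)
  have uvn: "{u, v} \<notin> ends ` set (steps ?q)"
  proof
    assume "{u, v} \<in> ends ` set (steps ?q)"
    then obtain d where d': "d \<in> set (steps ?q)" "ends d = {u, v}" by (metis imageE)
    moreover have "steps ?q = (v, w) # steps (w # ws @ [u])" by simp
    ultimately have "d \<in> set (steps (w # ws @ [u]))"
      using d by (auto simp: cc doubleton_eq_iff)
    with d'(2) have "v \<in> set (w # ws @ [u])" using ends_steps_subset by blast
    then show False using d by (auto simp: cc)
  qed
  have "edges_image {{u, v}} \<inter> edges_image (ends ` set (steps ?q)) \<subseteq> {pos u, pos v}"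
    using edges_images_meet[of "{{u, v}}" "ends ` set (steps ?q)"] uv sub' uvn by auto
  then show "simple_path (cycle_path pos crv c)"
    unfolding cp using ep wp wa d
    by (intro simple_path_join_loop) (auto simp add: cc edges_image_insert)
  show "pathfinish (cycle_path pos crv c) = pathstart (cycle_path pos crv c)"
    unfolding cp using ep wp by simp
  show "path_image (cycle_path pos crv c) = curve_of c"
    using walk_path_curve[OF sub] closed_steps[OF c] by (simp add: cycle_path_def cc)
qed

lemma winding_number_walk:
  assumes "ends ` set (steps xs) \<subseteq> E" "length xs \<ge> 2" "z \<notin> edges_image (ends ` set (steps xs))"
  shows "winding_number (walk_path pos crv xs) z =
    sum_list (map (\<lambda>(u, v). winding_number (edge_path pos crv u v) z) (steps xs))"
  using assms
proof (induction xs rule: remdups_adj.induct)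
  case (3 u v xs)
  then have uv: "{u, v} \<in> E" by auto
  note ep = edge_path_props[OF uv] arc_imp_path[OF edge_path_props(1)[OF uv]]
  show ?case
  proof (cases xs)
    case Nil
    then show ?thesis by simp
  next
    case (Cons w ws)
    have sub: "ends ` set (steps (v # xs)) \<subseteq> E" using 3 by auto
    have IH: "winding_number (walk_path pos crv (v # xs)) z =
      sum_list (map (\<lambda>(u, v). winding_number (edge_path pos crv u v) z) (steps (v # xs)))"
      using 3 by (cases "u = v"; simp add: Cons edges_image_insert)
    have "winding_number (edge_path pos crv u v +++ walk_path pos crv (v # xs)) z =
      winding_number (edge_path pos crv u v) z + winding_number (walk_path pos crv (v # xs)) z"
      using ep walk_path_curve[OF sub] 3(5)
      by (intro winding_number_join) (simp_all add: Cons edges_image_insert)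
    then show ?thesis using IH by (simp add: Cons)
  qed
qed auto

text \<open>Written as a sum over arrows, the winding number depends neither on the starting vertex of the
  cycle nor on the order of its arrows, and the contribution of one edge can be separated.\<close>

lemma winding_number_cycle:
  assumes c: "is_cycle E c" and z: "z \<notin> curve_of c"
  shows "winding_number (cycle_path pos crv c) z =
    (\<Sum>(u, v)\<in>set (arrows c). winding_number (edge_path pos crv u v) z)"
proof -
  have "length c \<ge> 3" "c \<noteq> []" "distinct c" "cycle_edges c \<subseteq> E" using c by (auto simp: is_cycle_arrows)
  then show ?thesis
    using winding_number_walk[of "c @ [hd c]" z] z closed_steps[OF c]
    by (simp add: cycle_path_def sum_list_distinct_conv_sum_set distinct_arrows
        flip: arrows_conv_steps)
qed

lemma Jordan_cycle:
  assumes "is_cycle E c"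
  shows "inside (curve_of c) \<noteq> {}" "open (inside (curve_of c))" "connected (inside (curve_of c))"
    "open (outside (curve_of c))" "connected (outside (curve_of c))"
    "bounded (inside (curve_of c))"
    "inside (curve_of c) \<inter> outside (curve_of c) = {}"
    "inside (curve_of c) \<union> outside (curve_of c) = - curve_of c"
    "frontier (inside (curve_of c)) = curve_of c"
  using Jordan_inside_outside[OF cycle_path_simple(1,2)[OF assms]]
  unfolding cycle_path_simple(3)[OF assms] by auto

text \<open>Unlike the whole arc, the open arc avoids all other edges and all vertices, so a cycle that does
  not contain the edge cannot cut it.\<close>

definition edge_interior :: "'v set \<Rightarrow> complex set" where
  "edge_interior e = path_image (crv e) - pos ` e"

lemma edge_interior:
  assumes "e \<in> E"
  shows "connected (edge_interior e)" "edge_interior e \<noteq> {}"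
    "path_image (crv e) \<subseteq> closure (edge_interior e)"
proof -
  note a = arc_crv[OF assms]
  have sp: "simple_path (crv e)" using a by (simp add: arc_imp_simple_path)
  have eq: "edge_interior e = path_image (crv e) - {pathstart (crv e), pathfinish (crv e)}"
    using crv_ends[OF assms] by (simp add: edge_interior_def)
  show "connected (edge_interior e)" "edge_interior e \<noteq> {}"
    unfolding eq using connected_simple_path_endless[OF sp] nonempty_simple_path_endless[OF sp]
    by auto
  have im: "edge_interior e = crv e ` {0<..<1}"
    unfolding eq by (rule simple_path_endless[OF sp])
  have "continuous_on (closure {0<..<1::real}) (crv e)"
    using a by (simp add: arc_def path_def)
  then have "crv e ` closure {0<..<1} \<subseteq> closure (crv e ` {0<..<1})"
    by (rule image_closure_subset) (auto simp: closure_subset)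
  then show "path_image (crv e) \<subseteq> closure (edge_interior e)"
    by (simp add: im path_image_def)
qed

lemma edge_interior_disjoint:
  assumes "e \<in> E" "F \<subseteq> E" "e \<notin> F"
  shows "edge_interior e \<inter> edges_image F = {}"
  using edges_images_meet[of "{e}" F] assms by (auto simp: edge_interior_def edges_image_insert)

section \<open>Splitting a cycle by a path inside it\<close>

text \<open>The number of these edges measures how much is drawn inside a cycle; the inductions over
  cycles decrease it.\<close>

definition inner_edges :: "'v list \<Rightarrow> 'v set set" where
  "inner_edges c = {e \<in> E. path_image (crv e) \<inter> inside (curve_of c) \<noteq> {}}"

lemma vertex_on_cycle:
  assumes "is_cycle E c"
  shows "pos v \<in> curve_of c \<longleftrightarrow> v \<in> set c"
proof -
  have "\<Union>(cycle_edges c) = set c"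
  proof
    show "\<Union>(cycle_edges c) \<subseteq> set c" using cycle_edge_subset by blast
    show "set c \<subseteq> \<Union>(cycle_edges c)"
      using arrows_cover[of _ c] by (force simp: cycle_edges_arrows)
  qed
  then show ?thesis using vertex_on_edges[of "cycle_edges c" v] assms by (simp add: is_cycle_arrows)
qed

lemma inner_edge_not_on_cycle: "e \<in> inner_edges c \<Longrightarrow> e \<notin> cycle_edges c"
  using inside_no_overlap[of "curve_of c"] unfolding inner_edges_def edges_image_def by blast

text \<open>The open arc is connected and avoids the cycle, so one of its points inside the cycle draws all of
  it inside.\<close>

lemma inner_edge_interior:
  assumes c: "is_cycle E c" and e: "e \<in> inner_edges c"
  shows "edge_interior e \<subseteq> inside (curve_of c)"
proof -
  have eE: "e \<in> E" and enc: "e \<notin> cycle_edges c" and cE: "cycle_edges c \<subseteq> E"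
    using e inner_edge_not_on_cycle c by (auto simp: inner_edges_def is_cycle_arrows)
  note J = Jordan_cycle[OF c]
  have dis: "edge_interior e \<inter> curve_of c = {}"
    by (rule edge_interior_disjoint[OF eE cE enc])
  have "inside (curve_of c) \<inter> closure (edge_interior e) \<noteq> {}"
    using e edge_interior(3)[OF eE] by (auto simp: inner_edges_def)
  then have "inside (curve_of c) \<inter> edge_interior e \<noteq> {}"
    using J(2) by (simp add: open_Int_closure_eq_empty)
  then show ?thesis
    using connectedD[OF edge_interior(1)[OF eE] J(2) J(4)] J(7,8) dis by blast
qed

text \<open>An end of an edge drawn inside is a limit of points inside, hence lies inside or on the cycle.\<close>

lemma inner_edge_vertex:
  assumes c: "is_cycle E c" and e: "e \<in> inner_edges c" and v: "v \<in> e"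
  shows "v \<in> set c \<or> pos v \<in> inside (curve_of c)"
proof -
  have eE: "e \<in> E" using e by (simp add: inner_edges_def)
  have "pos v \<in> closure (inside (curve_of c))"
    using edge_interior(3)[OF eE] vertex_on_edge[OF eE, of v] v
      closure_mono[OF inner_edge_interior[OF c e]] by blast
  then show ?thesis
    using Jordan_cycle(9)[OF c] vertex_on_cycle[OF c] closure_Un_frontier[of "inside (curve_of c)"] by auto
qed

lemma inner_vertex_edge:
  assumes "pos v \<in> inside (curve_of c)" "v \<in> e" "e \<in> E"
  shows "e \<in> inner_edges c"
  using assms vertex_on_edge[of e v] by (auto simp: inner_edges_def)

text \<open>Either some edge drawn inside joins two vertices of the cycle, and is itself such a path, or some
  vertex lies inside and \<open>ear_exists\<close> applies: a path that leaves this vertex without touching the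
  cycle stays inside.\<close>

lemma ear_inside:
  assumes tc: "two_connected E" and c: "is_cycle E c" and ne: "inner_edges c \<noteq> {}"
  shows "\<exists>a b P. a \<in> set c \<and> b \<in> set c \<and> a \<noteq> b \<and> set P \<inter> set c = {} \<and>
    simple_walk E a b (a # P @ [b]) \<and> ends ` set (steps (a # P @ [b])) \<subseteq> inner_edges c"
proof -
  obtain e where e: "e \<in> inner_edges c" using ne by blast
  then have eE: "e \<in> E" by (simp add: inner_edges_def)
  show ?thesis
  proof (cases "e \<subseteq> set c")
    case True
    obtain a b where ab: "e = {a, b}" "a \<noteq> b" using edge_pair[OF eE] .
    then show ?thesis
      using True e eE by (intro exI[of _ a] exI[of _ b] exI[of _ "[]"]) (auto simp: simple_walk_def)
  next
    case False
    then obtain x where x: "x \<in> e" "x \<notin> set c" by blast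
    then have xin: "pos x \<in> inside (curve_of c)" using inner_edge_vertex[OF c e] by blast
    have "card (set c) \<ge> 2" using c by (simp add: is_cycle_arrows distinct_card)
    from ear_exists[OF tc this x(2)] obtain a b P where P: "a \<in> set c" "b \<in> set c" "a \<noteq> b" "P \<noteq> []"
      "set P \<inter> set c = {}" "simple_walk E a b (a # P @ [b])"
      "\<And>p. p \<in> set P \<Longrightarrow> (x, p) \<in> {(a, b). a \<in> - set c \<and> b \<in> - set c \<and> {a, b} \<in> E}\<^sup>*" by blast
    have inner: "pos p \<in> inside (curve_of c)" if "p \<in> set P" for p
      using P(7)[OF that]
    proof (induction rule: rtrancl_induct)
      case base
      then show ?case by (rule xin)
    next
      case (step y z)
      then have "{y, z} \<in> inner_edges c" by (intro inner_vertex_edge[of y]) auto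
      then show ?case using step inner_edge_vertex[OF c, of "{y, z}" z] by auto
    qed
    have "ends d \<in> inner_edges c" if d: "d \<in> set (steps (a # P @ [b]))" for d
    proof -
      have dE: "ends d \<in> E" using P(6) d by (auto simp: simple_walk_def)
      have "fst d \<in> set (butlast (a # P @ [b]))" "snd d \<in> set (tl (a # P @ [b]))"
        using d by (metis imageI list.set_map map_fst_steps map_snd_steps)+
      then have fs: "fst d = a \<or> fst d \<in> set P" "snd d = b \<or> snd d \<in> set P"
        by (auto simp: butlast_append)
      have "fst d \<in> set P \<or> snd d \<in> set P"
      proof (rule ccontr)
        assume "\<not> ?thesis"
        \<comment> \<open>A step directly from \<open>a\<close> to \<open>b\<close> would make the walk pass \<open>a\<close> twice, as \<open>P\<close> is not empty.\<close>
        with fs have dd: "d = (a, b)" by (cases d) auto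
        obtain p ps where pp: "P = p # ps" using P(4) by (cases P) auto
        have "(a, b) \<in> set (steps (p # ps @ [b]))"
          using d P(6) by (auto simp: dd pp simple_walk_def)
        then have "a \<in> set (p # ps @ [b])" using step_in_set by fastforce
        then show False using P(6) by (auto simp: pp simple_walk_def)
      qed
      then obtain p where "p \<in> set P" "p \<in> ends d" by (auto simp: ends_def)
      then show ?thesis using inner dE by (intro inner_vertex_edge[of p]) auto
    qed
    then show ?thesis using P by blast
  qed
qed

text \<open>The curve of the cycle together with the path from \<open>ear_inside\<close> is a theta curve, made of three
  arcs from \<open>a\<close> to \<open>b\<close> with the middle one inside the closed curve of the outer two. It splits
  the inside into the insides of two smaller cycles. The edges of the path are inside the old cycle but
  on both new ones, so both have fewer inner edges. The new cycles traverse the path in opposite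
  directions, which makes weights along it cancel.\<close>

lemma cycle_split:
  assumes tc: "two_connected E" and c: "is_cycle E c" and ne: "inner_edges c \<noteq> {}"
  shows "\<exists>a A b B P. set (arrows c) = set (arrows (a # A @ b # B)) \<and>
    is_cycle E (a # A @ b # B) \<and> is_cycle E (a # A @ b # rev P) \<and> is_cycle E (a # P @ b # B) \<and>
    inside (curve_of (a # A @ b # rev P)) \<inter> inside (curve_of (a # P @ b # B)) = {} \<and>
    inside (curve_of c) - drawing \<subseteq>
      inside (curve_of (a # A @ b # rev P)) \<union> inside (curve_of (a # P @ b # B)) \<and>
    inner_edges (a # A @ b # rev P) \<subset> inner_edges c \<and> inner_edges (a # P @ b # B) \<subset> inner_edges c"
proof -
  from ear_inside[OF assms] obtain a b P where P: "a \<in> set c" "b \<in> set c" "a \<noteq> b"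
    "set P \<inter> set c = {}" "simple_walk E a b (a # P @ [b])"
    "ends ` set (steps (a # P @ [b])) \<subseteq> inner_edges c" by blast
  obtain X Y where XY: "c = X @ a # Y" using P(1) by (meson split_list)
  have "b \<in> set (Y @ X)" using P(2,3) XY by auto
  then obtain A B where AB: "Y @ X = A @ b # B" by (meson split_list)
  let ?c = "a # A @ b # B" and ?c1 = "a # A @ b # rev P" and ?c2 = "a # P @ b # B"
  have eqc: "set (arrows c) = set (arrows ?c)"
    using set_arrows_rotate[of X "a # Y"] AB by (simp add: XY)
  then have eqe: "cycle_edges c = cycle_edges ?c" by (simp add: cycle_edges_arrows)
  have mm: "mset c = mset ?c"
    using arg_cong[OF AB, of mset] by (simp add: XY ac_simps)
  have ms: "set c = set ?c" "length c = length ?c" "distinct ?c"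
    using mset_eq_setD[OF mm] mset_eq_length[OF mm] mset_eq_imp_distinct_iff[OF mm] c
    unfolding is_cycle_arrows by blast+
  have cyc: "is_cycle E ?c" using c ms eqe by (simp add: is_cycle_arrows)
  have dis: "distinct ?c" "distinct P" "a \<notin> set P" "b \<notin> set P" "set P \<inter> set A = {}" "set P \<inter> set B = {}"
    using ms P by (auto simp: simple_walk_def)
  define EA where "EA = ends ` set (steps (a # A @ [b]))"
  define EB where "EB = ends ` set (steps (b # B @ [a]))"
  define EP where "EP = ends ` set (steps (a # P @ [b]))"
  have rev_ends: "ends ` set (steps (rev xs)) = ends ` set (steps xs)" for xs :: "'v list"
    by (simp add: steps_rev image_image)
  have EP': "ends ` set (steps (b # rev P @ [a])) = EP"
    using rev_ends[of "a # P @ [b]"] by (simp add: EP_def)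
  have EB': "ends ` set (steps (a # rev B @ [b])) = EB"
    using rev_ends[of "b # B @ [a]"] by (simp add: EB_def)
  have ce: "cycle_edges ?c = EA \<union> EB" "cycle_edges ?c1 = EA \<union> EP" "cycle_edges ?c2 = EP \<union> EB"
    using EP' by (auto simp: cycle_edges_arrows arrows_split EA_def EB_def EP_def image_Un)
  have sub: "EA \<subseteq> E" "EB \<subseteq> E" "EP \<subseteq> E"
    using cyc P(5) ce(1) by (auto simp: is_cycle_arrows simple_walk_def EP_def)
  have EPin: "EP \<subseteq> inner_edges c" using P(6) by (simp add: EP_def)
  have EPdis: "EP \<inter> EA = {}" "EP \<inter> EB = {}"
    using EPin inner_edge_not_on_cycle eqe ce(1) by blast+
  have EABdis: "EA \<inter> EB = {}"
  proof -
    have "distinct (arrows ?c)" "inj_on ends (set (arrows ?c))"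
      using cyc inj_on_ends_arrows[of ?c] distinct_arrows[of ?c] by (auto simp: is_cycle_arrows)
    then have "set (steps (a # A @ [b])) \<inter> set (steps (b # B @ [a])) = {}"
      "inj_on ends (set (steps (a # A @ [b])) \<union> set (steps (b # B @ [a])))"
      unfolding arrows_split by simp_all
    then show ?thesis
      unfolding EA_def EB_def by (metis Un_upper1 Un_upper2 image_empty inj_on_image_Int)
  qed
  have UA: "\<Union>EA = insert a (insert b (set A))" and UB: "\<Union>EB = insert a (insert b (set B))"
    and UP: "\<Union>EP = insert a (insert b (set P))"
    unfolding EA_def EB_def EP_def by (subst Union_ends_steps; auto)+
  have len: "A \<noteq> [] \<or> P \<noteq> []" "B \<noteq> [] \<or> P \<noteq> []"
    using EPdis by (auto simp: EA_def EB_def EP_def insert_commute)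
  have cyc1: "is_cycle E ?c1" and cyc2: "is_cycle E ?c2"
    using dis ce sub len by (auto simp: is_cycle_arrows Suc_le_eq)
  have curves: "curve_of c = edges_image EA \<union> edges_image EB"
    "curve_of ?c1 = edges_image EA \<union> edges_image EP" "curve_of ?c2 = edges_image EB \<union> edges_image EP"
    by (auto simp: eqe ce edges_image_Un)
  let ?w = "walk_path pos crv"
  have walks: "ends ` set (steps (a # A @ [b])) \<subseteq> E" "ends ` set (steps (a # rev B @ [b])) \<subseteq> E"
    "ends ` set (steps (a # P @ [b])) \<subseteq> E"
    using sub EB' by (auto simp: EA_def EP_def)
  have arcs: "arc (?w (a # A @ [b]))" "arc (?w (a # rev B @ [b]))" "arc (?w (a # P @ [b]))"
    using walks dis by (auto intro!: walk_path_arc)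
  have ims: "path_image (?w (a # A @ [b])) = edges_image EA"
    "path_image (?w (a # rev B @ [b])) = edges_image EB"
    "path_image (?w (a # P @ [b])) = edges_image EP"
    using walk_path_curve[OF walks(1)] walk_path_curve[OF walks(2)] walk_path_curve[OF walks(3)]
    by (simp_all add: EB' EA_def EP_def)
  have eds: "pathstart (?w (a # A @ [b])) = pos a" "pathfinish (?w (a # A @ [b])) = pos b"
    "pathstart (?w (a # rev B @ [b])) = pos a" "pathfinish (?w (a # rev B @ [b])) = pos b"
    "pathstart (?w (a # P @ [b])) = pos a" "pathfinish (?w (a # P @ [b])) = pos b"
    using walk_path_curve[OF walks(1)] walk_path_curve[OF walks(2)] walk_path_curve[OF walks(3)]
    by simp_all
  have meets: "edges_image EA \<inter> edges_image EB = {pos a, pos b}"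
    "edges_image EA \<inter> edges_image EP = {pos a, pos b}"
    "edges_image EB \<inter> edges_image EP = {pos a, pos b}"
    using edges_images_meet[of EA EB] edges_images_meet[of EA EP] edges_images_meet[of EB EP]
      sub EPdis EABdis UA UB UP dis by (auto simp: Int_commute)
  have "EP \<noteq> {}" unfolding EP_def by (cases P) auto
  then obtain e where e: "e \<in> EP" by blast
  have PI: "edges_image EP \<inter> inside (edges_image EA \<union> edges_image EB) \<noteq> {}"
  proof -
    have "path_image (crv e) \<inter> inside (curve_of c) \<noteq> {}" using e EPin by (auto simp: inner_edges_def)
    moreover have "path_image (crv e) \<subseteq> edges_image EP" using e by (auto simp: edges_image_def)
    ultimately show ?thesis unfolding curves by blast
  qed
  have "pos a \<noteq> pos b" using P(3) inj_pos by (auto dest: injD)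
  from split_inside_simple_closed_curve[OF arc_imp_simple_path[OF arcs(1)] eds(1,2)
      arc_imp_simple_path[OF arcs(2)] eds(3,4) arc_imp_simple_path[OF arcs(3)] eds(5,6) this,
      unfolded ims, OF meets PI]
  have ins: "inside (curve_of ?c1) \<inter> inside (curve_of ?c2) = {}"
    "inside (curve_of ?c1) \<union> inside (curve_of ?c2) \<union> (edges_image EP - {pos a, pos b}) =
     inside (curve_of c)"
    unfolding curves by blast+
  have "inner_edges ?c1 \<subset> inner_edges c" "inner_edges ?c2 \<subset> inner_edges c"
  proof -
    have "inner_edges ?c1 \<subseteq> inner_edges c" "inner_edges ?c2 \<subseteq> inner_edges c"
      using ins(2) by (auto simp: inner_edges_def)
    moreover have "e \<notin> inner_edges ?c1" "e \<notin> inner_edges ?c2"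
      using inner_edge_not_on_cycle ce e by blast+
    ultimately show "inner_edges ?c1 \<subset> inner_edges c" "inner_edges ?c2 \<subset> inner_edges c"
      using e EPin by blast+
  qed
  moreover have "edges_image EP \<subseteq> drawing" using edges_image_mono[OF sub(3)] by blast
  ultimately show ?thesis
    using eqc cyc cyc1 cyc2 ins by blast
qed

section \<open>Bounded faces are the insides of cycles\<close>

lemma compact_drawing: "compact drawing"
  using compact_edges_image[of E] finite_imp_compact[of "range pos"] by (intro compact_Un) auto

lemma curve_subset_drawing: "is_cycle E c \<Longrightarrow> curve_of c \<subseteq> drawing"
  using edges_image_mono[of "cycle_edges c" E] by (auto simp: is_cycle_arrows)

lemma inner_faces_alt: "inner_faces E pos crv = {F \<in> components (- drawing). bounded F}"
  by (simp add: inner_faces_def edges_image_def)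

lemma connected_set_on_one_side:
  assumes c: "is_cycle E c" and F: "connected F" "F \<inter> drawing = {}" and x: "x \<in> F"
  shows "x \<in> inside (curve_of c) \<Longrightarrow> F \<subseteq> inside (curve_of c)"
    and "x \<in> outside (curve_of c) \<Longrightarrow> F \<subseteq> outside (curve_of c)"
proof -
  have cover: "F \<subseteq> inside (curve_of c) \<union> outside (curve_of c)"
    using Jordan_cycle(8)[OF c] F(2) curve_subset_drawing[OF c] by auto
  have "inside (curve_of c) \<inter> F = {} \<or> outside (curve_of c) \<inter> F = {}"
    by (rule connectedD[OF F(1) Jordan_cycle(2,4)[OF c] _ cover])
      (simp add: Jordan_cycle(7)[OF c])
  then show "x \<in> inside (curve_of c) \<Longrightarrow> F \<subseteq> inside (curve_of c)"
    and "x \<in> outside (curve_of c) \<Longrightarrow> F \<subseteq> outside (curve_of c)"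
    using cover x by blast+
qed

lemma inside_is_face:
  assumes c: "is_cycle E c" and dis: "inside (curve_of c) \<inter> drawing = {}"
  shows "inside (curve_of c) \<in> inner_faces E pos crv"
proof -
  have "D = inside (curve_of c)"
    if "D \<noteq> {}" "inside (curve_of c) \<subseteq> D" "D \<subseteq> - drawing" "connected D" for D
  proof -
    obtain x where "x \<in> inside (curve_of c)" using Jordan_cycle(1)[OF c] by blast
    then have "D \<subseteq> inside (curve_of c)" using connected_set_on_one_side(1)[OF c, of D x] that by blast
    with that show ?thesis by blast
  qed
  then show ?thesis
    using Jordan_cycle(1,3,6)[OF c] dis unfolding inner_faces_alt in_components_maximal by blast
qed

text \<open>It remains to exclude vertices inside, since a face also avoids the points of vertices; but every
  vertex is the end of an edge.\<close>

lemma empty_cycle_face: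
  assumes tc: "two_connected E" and c: "is_cycle E c" and em: "inner_edges c = {}"
  shows "inside (curve_of c) \<in> inner_faces E pos crv"
proof (rule inside_is_face[OF c])
  have "x \<notin> inside (curve_of c)" if "x \<in> edges_image E" for x
    using em that by (auto simp: edges_image_def inner_edges_def)
  moreover have "pos v \<notin> inside (curve_of c)" for v
  proof
    assume v: "pos v \<in> inside (curve_of c)"
    obtain u where "u \<in> set c" using c by (cases c) (auto simp: is_cycle_arrows)
    then have "u \<noteq> v"
      using v vertex_on_cycle[OF c] inside_no_overlap by blast
    then obtain s where "{v, s} \<in> E" using two_connected_other_neighbour[OF tc] by blast
    then have "{v, s} \<in> inner_edges c" using inner_vertex_edge[OF v] by blast
    then show False using em by blast
  qed
  ultimately show "inside (curve_of c) \<inter> drawing = {}" by blast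
qed

text \<open>An edge off the cycle meets the curve in at most two points, so it is not contained in it.\<close>

lemma boundary_edges_inside:
  assumes c: "is_cycle E c"
  shows "boundary_edges E crv (inside (curve_of c)) = cycle_edges c"
proof -
  have cE: "cycle_edges c \<subseteq> E" using c by (simp add: is_cycle_arrows)
  have "e \<in> cycle_edges c" if "e \<in> E" "path_image (crv e) \<subseteq> curve_of c" for e
  proof (rule ccontr)
    assume "e \<notin> cycle_edges c"
    from edge_interior_disjoint[OF that(1) cE this] edge_interior(2)[OF that(1)] that(2)
    show False by (auto simp: edge_interior_def)
  qed
  moreover have "path_image (crv e) \<subseteq> curve_of c" if "e \<in> cycle_edges c" for e
    using that by (auto simp: edges_image_def)
  ultimately show ?thesis
    using cE unfolding boundary_edges_def Jordan_cycle(9)[OF c] by blast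
qed

text \<open>Build the drawing up from one vertex by edges that keep the subgraph connected. Adding an edge to a
  new vertex attaches an arc, which separates no points, along a single point. Adding an edge between old
  vertices attaches a cycle of the graph along a connected arc, namely a path between the ends of the edge
  within the old subgraph. In both cases Janiszewski's theorem shows that points separated neither by
  the old drawing nor by the attached set are not separated by the union. A connected subgraph with a
  maximal number of edges that does not separate the two points is therefore the whole graph.\<close>

lemma separated_by_cycle:
  assumes tc: "two_connected E" and xy: "x \<notin> drawing" "y \<notin> drawing"
    and cyc: "\<And>c. is_cycle E c \<Longrightarrow> connected_component (- curve_of c) x y"
  shows "connected_component (- drawing) x y"
proof -
  define img where "img = (\<lambda>S F. pos ` S \<union> edges_image F)"
  define good where "good = (\<lambda>S F. F \<subseteq> E \<and> (\<forall>e\<in>F. e \<subseteq> S) \<and> induced_connected F S \<and>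
    connected_component (- img S F) x y)"
  have sub: "img S F \<subseteq> drawing" if "F \<subseteq> E" for S F
    using edges_image_mono[OF that] by (auto simp: img_def)
  have cpt: "compact (img S F)" if "F \<subseteq> E" for S F
    unfolding img_def using compact_edges_image[OF that] finite_imp_compact[of "pos ` S"]
    by (intro compact_Un) auto
  have meet: "img S F \<inter> path_image (crv e) = pos ` (e \<inter> S)"
    if "F \<subseteq> E" "\<forall>e\<in>F. e \<subseteq> S" "e \<in> E" "e \<notin> F" for S F e
  proof -
    have "edges_image F \<inter> path_image (crv e) = pos ` (\<Union>F \<inter> e)"
      using edges_images_meet[of F "{e}"] that by (simp add: edges_image_insert)
    moreover have "pos ` S \<inter> path_image (crv e) = pos ` (e \<inter> S)"
      using vertex_on_edge[OF that(3)] by auto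
    moreover have "\<Union>F \<inter> e \<subseteq> e \<inter> S" using that(2) by auto
    ultimately show ?thesis unfolding img_def by (auto simp: Int_Un_distrib2)
  qed
  have base: "good {v} {}" for v
  proof -
    have "connected (- {pos v})" by (rule connected_punctured_universe) simp
    then have "connected_component (- {pos v}) x y"
      using xy by (auto simp: connected_component_def)
    then show ?thesis by (simp add: good_def img_def induced_connected_def)
  qed
  have chord: "good S (insert {u, v} F)"
    if g: "good S F" and u: "u \<in> S" "v \<in> S" and e: "{u, v} \<in> E" "{u, v} \<notin> F" for S F u v
  proof -
    have gF: "F \<subseteq> E" "\<forall>e\<in>F. e \<subseteq> S" "induced_connected F S" "connected_component (- img S F) x y"
      using g by (simp_all add: good_def)
    then have "(u, v) \<in> {(a, b). a \<in> S \<and> b \<in> S \<and> {a, b} \<in> F}\<^sup>*"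
      using u unfolding induced_connected_def by blast
    then obtain xs where xs: "simple_walk F u v xs" "set xs \<subseteq> S"
      using rtrancl_simple_walk[of u v S F] u(1) by auto
    have uv: "u \<noteq> v" by (rule edge_distinct[OF e(1)])
    obtain w ws where ws: "xs = u # w # ws"
      using xs(1) uv by (cases xs rule: remdups_adj.cases) (auto simp: simple_walk_def)
    have "ws \<noteq> []" using xs(1) e(2) by (auto simp: ws simple_walk_def)
    then have len: "length xs \<ge> 3" by (cases ws) (auto simp: ws)
    have xsE: "simple_walk E u v xs" using simple_walk_mono[OF xs(1) gF(1)] .
    note cl = closed_walk_cycle[OF xsE e(1) len]
    have ce: "cycle_edges xs = insert {u, v} (ends ` set (steps xs))"
      by (auto simp: cycle_edges_arrows cl(2) insert_commute)
    have sE: "ends ` set (steps xs) \<subseteq> E" and sF: "ends ` set (steps xs) \<subseteq> F"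
      using xs(1) xsE by (auto simp: simple_walk_def)
    note wp = walk_path_curve[OF sE]
    have pe: "pos u \<in> edges_image (ends ` set (steps xs))" "pos v \<in> edges_image (ends ` set (steps xs))"
    proof -
      have "2 \<le> length xs" "hd xs = u" "last xs = v" using len xs(1) by (auto simp: simple_walk_def)
      then show "pos u \<in> edges_image (ends ` set (steps xs))" "pos v \<in> edges_image (ends ` set (steps xs))"
        using wp by (metis pathstart_in_path_image, metis pathfinish_in_path_image)
    qed
    \<comment> \<open>The chord adds only its two ends to the intersection, and these already lie on the path.\<close>
    have "img S F \<inter> curve_of xs = edges_image (ends ` set (steps xs))"
    proof -
      have "img S F \<inter> path_image (crv {u, v}) = {pos u, pos v}"
        using meet[OF gF(1,2) e] u by simp
      then show ?thesis
        using pe edges_image_mono[OF sF] unfolding ce edges_image_insert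
        by (subst Int_Un_distrib) (auto simp: img_def)
    qed
    moreover have "connected (edges_image (ends ` set (steps xs)))"
    proof -
      have "2 \<le> length xs" using len by linarith
      with wp show ?thesis by (metis connected_path_image)
    qed
    ultimately have "connected_component (- (img S F \<union> curve_of xs)) x y"
      using cpt[OF gF(1)] compact_edges_image[of "cycle_edges xs"] cl(1) gF(4) cyc[OF cl(1)]
      by (intro Janiszewski) (auto simp: is_cycle_arrows intro: compact_imp_closed)
    moreover have "img S F \<union> curve_of xs = img S (insert {u, v} F)"
      using edges_image_mono[OF sF] unfolding ce edges_image_insert
      by (auto simp: img_def edges_image_insert)
    moreover have "induced_connected (insert {u, v} F) S"
      using induced_connected_insert[OF gF(3) u(1), of "insert {u, v} F" v] u(2)
      by (simp add: insert_absorb subset_insertI)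
    ultimately show ?thesis using gF(1,2) u e(1) unfolding good_def by auto
  qed
  have pendant: "good (insert v S) (insert {u, v} F)"
    if g: "good S F" and u: "u \<in> S" "v \<notin> S" and e: "{u, v} \<in> E" for S F u v
  proof -
    have gF: "F \<subseteq> E" "\<forall>e\<in>F. e \<subseteq> S" "connected_component (- img S F) x y" "induced_connected F S"
      using g by (simp_all add: good_def)
    have eF: "{u, v} \<notin> F" using gF(2) u(2) by auto
    let ?p = "path_image (crv {u, v})"
    have "img S F \<inter> ?p = {pos u}"
      using meet[OF gF(1,2) e eF] u by auto
    moreover have "connected_component (- ?p) x y"
    proof -
      have "connected (- ?p)" using connected_arc_complement[OF arc_crv[OF e]] by simp
      moreover have "?p \<subseteq> drawing" using e by (auto simp: edges_image_def)
      ultimately show ?thesis using xy unfolding connected_component_def by blast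
    qed
    ultimately have "connected_component (- (img S F \<union> ?p)) x y"
      using cpt[OF gF(1)] arc_crv[OF e] gF(3)
      by (intro Janiszewski) (auto simp: closed_arc_image)
    moreover have "img S F \<union> ?p = img (insert v S) (insert {u, v} F)"
      using vertex_on_edge[OF e, of v] by (auto simp: img_def edges_image_insert)
    moreover have "induced_connected (insert {u, v} F) (insert v S)"
      by (rule induced_connected_insert[OF gF(4) u(1)]) auto
    ultimately show ?thesis using gF e u(1) unfolding good_def by auto
  qed
  have "\<exists>p. (case p of (S, F) \<Rightarrow> good S F) \<and>
    (\<forall>q. (case q of (S, F) \<Rightarrow> good S F) \<longrightarrow> card (snd q) \<le> card (snd p))"
  proof (rule ex_has_greatest_nat[of _ "({undefined}, {})" _ "Suc (card E)"])
    show "case ({undefined}, {}) of (S, F) \<Rightarrow> good S F" using base by simp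
    show "\<forall>q. (case q of (S, F) \<Rightarrow> good S F) \<longrightarrow> card (snd q) < Suc (card E)"
      by (auto simp: good_def less_Suc_eq_le intro: card_mono)
  qed
  then obtain S F where SF: "good S F" and max: "\<And>S' F'. good S' F' \<Longrightarrow> card F' \<le> card F"
    by auto
  have no_extension: "\<not> good S' (insert e F)" if "e \<notin> F" for S' e
    using max[of S' "insert e F"] that by auto
  have "S = UNIV"
  proof (rule ccontr)
    assume "S \<noteq> UNIV"
    moreover obtain s where "s \<in> S" using SF by (auto simp: good_def induced_connected_def)
    ultimately obtain a b where ab: "a \<in> S" "b \<notin> S" "{a, b} \<in> E"
      using two_connected_crossing_edge[OF tc] by (metis UNIV_eq_I)
    then have "{a, b} \<notin> F" using SF by (auto simp: good_def)
    then show False using pendant[OF SF ab] no_extension by blast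
  qed
  moreover have "F = E"
  proof (rule ccontr)
    assume "F \<noteq> E"
    then obtain e where e: "e \<in> E" "e \<notin> F" using SF by (auto simp: good_def)
    obtain u v where "e = {u, v}" using edge_pair[OF e(1)] by metis
    then show False using chord[OF SF, of u v] no_extension[OF e(2)] e \<open>S = UNIV\<close> by auto
  qed
  ultimately show ?thesis using SF by (simp add: good_def img_def)
qed

text \<open>A point of the bounded face and a point of the unbounded one are separated by the drawing, hence by
  a cycle. The second point lies outside this cycle, so the first lies inside.\<close>

lemma inner_face_within_cycle:
  assumes tc: "two_connected E" and F: "F \<in> inner_faces E pos crv"
  shows "\<exists>c. is_cycle E c \<and> F \<subseteq> inside (curve_of c)"
proof -
  have Fc: "F \<in> components (- drawing)" "bounded F" using F by (auto simp: inner_faces_alt)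
  then obtain x where x: "x \<notin> drawing" "F = connected_component_set (- drawing) x"
    by (auto simp: components_def)
  have xF: "x \<in> F" using x by (simp add: connected_component_refl_eq)
  have "outside drawing \<noteq> {}"
    using compact_drawing by (intro outside_bounded_nonempty compact_imp_bounded)
  then obtain y where y: "y \<in> outside drawing" by blast
  then have y': "y \<notin> drawing" "\<not> bounded (connected_component_set (- drawing) y)"
    by (auto simp: outside_def)
  have "\<not> connected_component (- drawing) x y"
    using y'(2) Fc(2) x(2) by (metis connected_component_eq mem_Collect_eq)
  then obtain c where c: "is_cycle E c" "\<not> connected_component (- curve_of c) x y"
    using separated_by_cycle[OF tc x(1) y'(1)] by blast
  note J = Jordan_cycle[OF c(1)]
  have yo: "y \<in> outside (curve_of c)"
    using y outside_mono[OF curve_subset_drawing[OF c(1)]] by blast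
  have "x \<notin> outside (curve_of c)"
  proof
    assume "x \<in> outside (curve_of c)"
    then have "connected_component (- curve_of c) x y"
      unfolding connected_component_def using J(5,8) yo by (intro exI[of _ "outside (curve_of c)"]) blast
    then show False using c(2) by simp
  qed
  then have "x \<in> inside (curve_of c)"
    using J(8) x(1) curve_subset_drawing[OF c(1)] by blast
  then have "F \<subseteq> inside (curve_of c)"
    using connected_set_on_one_side(1)[OF c(1) _ _ xF] in_components_connected[OF Fc(1)]
      in_components_subset[OF Fc(1)] by blast
  then show ?thesis using c(1) by blast
qed

text \<open>Start from a cycle around the face and split it while something is drawn inside. The face avoids
  the splitting path, so it stays inside one of the two parts. When nothing is left inside, the inside is
  itself a face.\<close>

lemma inner_face_is_inside:
  assumes tc: "two_connected E" and F: "F \<in> inner_faces E pos crv"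
  shows "\<exists>c. is_cycle E c \<and> F = inside (curve_of c)"
proof -
  have Fc: "F \<in> components (- drawing)" using F by (auto simp: inner_faces_alt)
  have Fp: "F \<noteq> {}" "connected F" "F \<inter> drawing = {}"
    using in_components_nonempty[OF Fc] in_components_connected[OF Fc] in_components_subset[OF Fc] by auto
  obtain x where x: "x \<in> F" using Fp(1) by blast
  have "\<exists>c. is_cycle E c \<and> F = inside (curve_of c)"
    if "is_cycle E c" "F \<subseteq> inside (curve_of c)" for c
    using that
  proof (induction "card (inner_edges c)" arbitrary: c rule: less_induct)
    case (less c)
    show ?case
    proof (cases "inner_edges c = {}")
      case True
      then have "inside (curve_of c) \<in> components (- drawing)"
        using empty_cycle_face[OF tc less(2)] by (simp add: inner_faces_alt)
      then have "F = inside (curve_of c)"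
        using components_eq[OF Fc] less(3) Fp(1) by blast
      then show ?thesis using less(2) by blast
    next
      case False
      from cycle_split[OF tc less(2) this] obtain c1 c2 where
        s: "is_cycle E c1" "is_cycle E c2"
          "inside (curve_of c) - drawing \<subseteq> inside (curve_of c1) \<union> inside (curve_of c2)"
          "inner_edges c1 \<subset> inner_edges c" "inner_edges c2 \<subset> inner_edges c"
        by blast
      have "card (inner_edges c1) < card (inner_edges c)" "card (inner_edges c2) < card (inner_edges c)"
        using s(4,5) by (auto intro: psubset_card_mono)
      moreover have "x \<in> inside (curve_of c1) \<or> x \<in> inside (curve_of c2)"
        using s(3) x less(3) Fp(3) by blast
      ultimately show ?thesis
        using connected_set_on_one_side(1)[OF _ Fp(2,3) x] s(1,2) less(1) by blast
    qed
  qed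
  then show ?thesis using inner_face_within_cycle[OF assms] by blast
qed

text \<open>The face \<open>F\<close> that a face cycle bounds is the inside of some cycle \<open>c'\<close>, whose edges are the
  boundary edges of \<open>F\<close>. So \<open>c'\<close> and \<open>c\<close> have the same curve.\<close>

lemma face_cycle_inside:
  assumes tc: "two_connected E" and c: "face_cycle E pos crv c"
  shows "inside (curve_of c) \<in> inner_faces E pos crv"
proof -
  obtain F where F: "F \<in> inner_faces E pos crv" "cycle_edges c = boundary_edges E crv F"
    using c by (auto simp: face_cycle_def)
  obtain c' where c': "is_cycle E c'" "F = inside (curve_of c')"
    using inner_face_is_inside[OF tc F(1)] by blast
  then have "cycle_edges c = cycle_edges c'" using boundary_edges_inside[OF c'(1)] F(2) by simp
  then show ?thesis using F(1) c'(2) by simp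
qed

lemma empty_face_cycle:
  assumes "two_connected E" "is_cycle E c" "inner_edges c = {}"
  shows "face_cycle E pos crv c"
  using empty_cycle_face[OF assms] boundary_edges_inside[OF assms(2)] assms(2)
  by (auto simp: face_cycle_def)

section \<open>Clockwise face cycles traverse a common edge in opposite directions\<close>

text \<open>Suppose that both cycles contain the arrow \<open>d\<close>, and let \<open>h\<close> be the difference of their
  winding numbers. The contribution of \<open>d\<close> cancels in \<open>h\<close>, so \<open>h\<close> is continuous at an interior
  point \<open>m\<close> of the edge. But \<open>m\<close> is a boundary point of both faces, and \<open>h\<close> is \<open>-1 - 0\<close> on
  one and \<open>0 - (-1)\<close> on the other.\<close>

lemma clockwise_face_cycles_arrows_disjoint:
  assumes tc: "two_connected E"
    and c: "face_cycle E pos crv c" "clockwise pos crv c"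
    and c': "face_cycle E pos crv c'" "clockwise pos crv c'"
    and ne: "cycle_edges c \<noteq> cycle_edges c'"
  shows "set (arrows c) \<inter> set (arrows c') = {}"
proof (rule ccontr)
  assume "\<not> ?thesis"
  then obtain d where d: "d \<in> set (arrows c)" "d \<in> set (arrows c')" by blast
  have cyc: "is_cycle E c" "is_cycle E c'" using c(1) c'(1) by (auto simp: face_cycle_def)
  let ?F = "inside (curve_of c)" and ?F' = "inside (curve_of c')"
  have comp: "?F \<in> components (- drawing)" "?F' \<in> components (- drawing)"
    using face_cycle_inside[OF tc c(1)] face_cycle_inside[OF tc c'(1)] by (auto simp: inner_faces_alt)
  have "?F \<noteq> ?F'"
    using boundary_edges_inside[OF cyc(1)] boundary_edges_inside[OF cyc(2)] ne by metis
  then have dis: "?F \<inter> ?F' = {}" using components_eq[OF comp] by blast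
  have nd: "?F \<inter> drawing = {}" "?F' \<inter> drawing = {}"
    using in_components_subset[OF comp(1)] in_components_subset[OF comp(2)] by auto
  have dE: "ends d \<in> E" using d(1) cyc(1) by (auto simp: is_cycle_arrows cycle_edges_arrows)
  obtain m where m: "m \<in> edge_interior (ends d)" using edge_interior(2)[OF dE] by blast
  let ?wn = "\<lambda>z (u, v). winding_number (edge_path pos crv u v) z"
  define h where "h = (\<lambda>z. sum (?wn z) (set (arrows c) - {d}) - sum (?wn z) (set (arrows c') - {d}))"
  have cont1: "isCont (\<lambda>z. sum (?wn z) (set (arrows b) - {d})) m"
    if b: "is_cycle E b" "d \<in> set (arrows b)" for b
  proof -
    have "isCont (\<lambda>z. ?wn z d') m" if d': "d' \<in> set (arrows b) - {d}" for d'
    proof -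
      obtain u v where uv: "d' = (u, v)" by (cases d')
      have uvE: "{u, v} \<in> E" using d' b(1) by (auto simp: uv is_cycle_arrows cycle_edges_arrows)
      have "ends d' \<noteq> ends d"
        using inj_on_ends_arrows[of b] b d' by (auto simp: is_cycle_arrows inj_on_def simp del: ends_pair)
      then have "m \<notin> path_image (crv {u, v})"
        using edge_interior_disjoint[OF dE, of "{{u, v}}"] m uvE by (auto simp: uv edges_image_insert)
      then show ?thesis
        using edge_path_props[OF uvE]
        by (simp add: uv continuous_at_winding_number arc_imp_path)
    qed
    then show ?thesis by (intro continuous_sum) auto
  qed
  have "isCont h m" unfolding h_def using cont1 cyc d by (intro continuous_diff) auto
  then have "0 < (1::real) \<longrightarrow> (\<exists>\<delta>>0. \<forall>z. dist z m < \<delta> \<longrightarrow> dist (h z) (h m) < 1)"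
    unfolding continuous_at_eps_delta by (rule spec)
  then obtain \<delta> where \<delta>: "\<delta> > 0" "\<And>z. dist z m < \<delta> \<Longrightarrow> dist (h z) (h m) < 1"
    by auto
  have h_eq: "h z = winding_number (cycle_path pos crv c) z - winding_number (cycle_path pos crv c') z"
    if "z \<notin> drawing" for z
  proof -
    have "z \<notin> curve_of c" "z \<notin> curve_of c'" using that curve_subset_drawing cyc by blast+
    then show ?thesis
      using winding_number_cycle[OF cyc(1)] winding_number_cycle[OF cyc(2)] d
      by (simp add: h_def sum.remove[of "set (arrows c)" d] sum.remove[of "set (arrows c')" d])
  qed
  have zero: "winding_number (cycle_path pos crv b) z = 0"
    if "is_cycle E b" "z \<notin> inside (curve_of b)" "z \<notin> drawing" for b z
  proof -
    have "z \<in> outside (curve_of b)"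
      using that Jordan_cycle(8)[OF that(1)] curve_subset_drawing[OF that(1)] by blast
    then show ?thesis
      using cycle_path_simple[OF that(1)] by (intro winding_number_zero_in_outside) (auto simp: simple_path_imp_path)
  qed
  have mcl: "m \<in> closure (inside (curve_of b))" if "is_cycle E b" "d \<in> set (arrows b)" for b
  proof -
    have "m \<in> curve_of b"
      using m that(2) by (auto simp: edge_interior_def edges_image_def cycle_edges_arrows)
    then show ?thesis using Jordan_cycle(9)[OF that(1)] by (metis Diff_iff frontier_def)
  qed
  obtain z where z: "z \<in> ?F" "dist z m < \<delta>"
    using mcl[OF cyc(1) d(1)] \<delta>(1) by (auto simp: closure_approachable)
  obtain z' where z': "z' \<in> ?F'" "dist z' m < \<delta>"
    using mcl[OF cyc(2) d(2)] \<delta>(1) by (auto simp: closure_approachable)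
  have outs: "z \<notin> ?F'" "z' \<notin> ?F" "z \<notin> drawing" "z' \<notin> drawing"
    using z(1) z'(1) dis nd by blast+
  have "h z = -1"
    using h_eq[of z] zero[OF cyc(2), of z] z(1) outs c(2) cycle_path_simple(3)[OF cyc(1)]
    by (auto simp: clockwise_def)
  moreover have "h z' = 1"
    using h_eq[of z'] zero[OF cyc(1), of z'] z'(1) outs c'(2) cycle_path_simple(3)[OF cyc(2)]
    by (auto simp: clockwise_def)
  ultimately have "dist (h z) (h z') = 2" by (simp add: dist_norm)
  moreover have "dist (h z) (h z') < 2"
    using \<delta>(2)[OF z(2)] \<delta>(2)[OF z'(2)] dist_triangle2[of "h z" "h z'" "h m"] by linarith
  ultimately show False by simp
qed

end

section \<open>Weights that are trivial around the face cycles\<close>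

lemma prod_list_there_and_back:
  fixes w :: "'a \<times> 'a \<Rightarrow> complex"
  assumes "\<And>d. d \<in> set l \<Longrightarrow> w d * w (prod.swap d) = 1"
  shows "prod_list (map w (rev (map prod.swap l))) * prod_list (map w l) = 1"
  using assms
proof (induction l)
  case (Cons d l)
  have "prod_list (map w (rev (map prod.swap (d # l)))) * prod_list (map w (d # l)) =
    (prod_list (map w (rev (map prod.swap l))) * prod_list (map w l)) * (w d * w (prod.swap d))"
    by (simp add: algebra_simps)
  then show ?case using Cons by simp
qed simp

context plane_graph begin

text \<open>In \<open>cycle_split\<close> the product around a cycle is the product of those around its two parts, since
  the path between them is traversed there and back. Cycles that cannot be split are face cycles.\<close>

lemma trivial_on_faces_trivial_on_cycles:
  fixes w :: "'v \<times> 'v \<Rightarrow> complex"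
  assumes tc: "two_connected E"
    and w: "\<And>d. ends d \<in> E \<Longrightarrow> w d * w (prod.swap d) = 1"
    and faces: "\<And>c. face_cycle E pos crv c \<Longrightarrow> prod w (set (arrows c)) = 1"
    and c: "is_cycle E c"
  shows "prod w (set (arrows c)) = 1"
  using c
proof (induction "card (inner_edges c)" arbitrary: c rule: less_induct)
  case (less c)
  show ?case
  proof (cases "inner_edges c = {}")
    case True
    then show ?thesis using faces empty_face_cycle[OF tc less(2)] by blast
  next
    case False
    from cycle_split[OF tc less(2) this] obtain a A b B P where
      s: "set (arrows c) = set (arrows (a # A @ b # B))"
        "is_cycle E (a # A @ b # B)" "is_cycle E (a # A @ b # rev P)" "is_cycle E (a # P @ b # B)"
        "inner_edges (a # A @ b # rev P) \<subset> inner_edges c" "inner_edges (a # P @ b # B) \<subset> inner_edges c"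
      by blast
    have cards: "card (inner_edges (a # A @ b # rev P)) < card (inner_edges c)"
      "card (inner_edges (a # P @ b # B)) < card (inner_edges c)"
      using s(5,6) by (auto intro: psubset_card_mono)
    let ?w = "\<lambda>xs. prod_list (map w xs)"
    have pl: "prod w (set (arrows b)) = ?w (arrows b)" if "is_cycle E b" for b
      using that by (simp add: is_cycle_arrows prod.distinct_set_conv_list distinct_arrows)
    have "ends ` set (steps (a # P @ [b])) \<subseteq> E"
      using s(4) by (auto simp: is_cycle_arrows cycle_edges_arrows arrows_split)
    then have "?w (steps (rev (a # P @ [b]))) * ?w (steps (a # P @ [b])) = 1"
      unfolding steps_rev by (intro prod_list_there_and_back w) auto
    then have P: "?w (steps (b # rev P @ [a])) * ?w (steps (a # P @ [b])) = 1" by simp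
    have "?w (steps (a # A @ [b])) * ?w (steps (b # rev P @ [a])) = 1"
      using less(1)[OF cards(1) s(3)] pl[OF s(3)] by (simp add: arrows_split)
    moreover have "?w (steps (a # P @ [b])) * ?w (steps (b # B @ [a])) = 1"
      using less(1)[OF cards(2) s(4)] pl[OF s(4)] by (simp add: arrows_split)
    ultimately have "?w (steps (a # A @ [b])) * ?w (steps (b # B @ [a])) = 1"
      using P by (metis mult.assoc mult.commute mult.right_neutral)
    then show ?thesis using pl[OF s(2)] by (simp add: s(1) arrows_split)
  qed
qed

end

section \<open>Switching equivalence and gains\<close>

lemma hermitian_edge:
  assumes "partial_orientation E \<phi>" "{u, v} \<in> E"
  shows "hermitian_adjacency E \<phi> $ u $ v \<in> {1, \<i>, -\<i>}"
    and "hermitian_adjacency E \<phi> $ v $ u = cnj (hermitian_adjacency E \<phi> $ u $ v)"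
    and "hermitian_adjacency E \<phi> $ u $ v * hermitian_adjacency E \<phi> $ v $ u = 1"
  using assms by (auto simp: hermitian_adjacency_def partial_orientation_def insert_commute)

lemma hermitian_non_edge: "{u, v} \<notin> E \<Longrightarrow> hermitian_adjacency E \<phi> $ u $ v = 0"
  by (simp add: hermitian_adjacency_def)

text \<open>The choice operator behind \<open>matrix_inv\<close> is evaluated once here, by exhibiting the inverse of a
  diagonal matrix; afterwards switching is a statement about single entries.\<close>

lemma diagonal_conjugation:
  fixes D M :: "complex ^ 'n ^ 'n::finite"
  assumes "\<And>u v. u \<noteq> v \<Longrightarrow> D $ u $ v = 0" "\<And>u. D $ u $ u \<noteq> 0"
  shows "(matrix_inv D ** M ** D) $ u $ v = inverse (D $ u $ u) * M $ u $ v * D $ v $ v"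
proof -
  define I :: "complex ^ 'n ^ 'n" where "I = (\<chi> u v. if u = v then inverse (D $ u $ u) else 0)"
  have l: "(I ** A) $ u $ v = inverse (D $ u $ u) * A $ u $ v" for A :: "complex ^ 'n ^ 'n" and u v
  proof -
    have "(I ** A) $ u $ v = (\<Sum>k\<in>UNIV. I $ u $ k * A $ k $ v)"
      by (simp add: matrix_matrix_mult_def)
    also have "\<dots> = (\<Sum>k\<in>UNIV. if k = u then inverse (D $ u $ u) * A $ u $ v else 0)"
      by (rule sum.cong) (auto simp: I_def)
    finally show ?thesis by simp
  qed
  have r: "(A ** D) $ u $ v = A $ u $ v * D $ v $ v" for A :: "complex ^ 'n ^ 'n" and u v
  proof -
    have "(A ** D) $ u $ v = (\<Sum>k\<in>UNIV. A $ u $ k * D $ k $ v)"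
      by (simp add: matrix_matrix_mult_def)
    also have "\<dots> = (\<Sum>k\<in>UNIV. if k = v then A $ u $ v * D $ v $ v else 0)"
      by (rule sum.cong) (auto simp: assms(1))
    finally show ?thesis by simp
  qed
  have ID: "I ** D = Finite_Cartesian_Product.mat 1" "D ** I = Finite_Cartesian_Product.mat 1"
  proof -
    show "I ** D = Finite_Cartesian_Product.mat 1"
      using assms by (auto simp: Finite_Cartesian_Product.vec_eq_iff l Finite_Cartesian_Product.mat_def)
    then show "D ** I = Finite_Cartesian_Product.mat 1" by (simp add: matrix_left_right_inverse)
  qed
  from ID have "D ** matrix_inv D = Finite_Cartesian_Product.mat 1 \<and>
      matrix_inv D ** D = Finite_Cartesian_Product.mat 1"
    unfolding matrix_inv_def
    by (intro someI[of "\<lambda>A. D ** A = Finite_Cartesian_Product.mat 1 \<and>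
      A ** D = Finite_Cartesian_Product.mat 1" I] conjI)
  then have "matrix_inv D = I"
    using ID(2) by (metis matrix_mul_assoc matrix_mul_lid matrix_mul_rid)
  then show ?thesis by (simp add: r l)
qed

lemma switching_equivalent_iff:
  "switching_equivalent E \<phi> \<psi> \<longleftrightarrow> (\<exists>p. (\<forall>u. p u \<in> {1, -1, \<i>, -\<i>}) \<and>
     (\<forall>u v. hermitian_adjacency E \<psi> $ u $ v =
        inverse (p u) * hermitian_adjacency E \<phi> $ u $ v * p v))"
proof
  assume "switching_equivalent E \<phi> \<psi>"
  then obtain D :: "complex ^ 'a ^ 'a" where D: "\<And>u v. u \<noteq> v \<Longrightarrow> D $ u $ v = 0"
    "\<And>u. D $ u $ u \<in> {1, -1, \<i>, -\<i>}"
    "matrix_inv D ** hermitian_adjacency E \<phi> ** D = hermitian_adjacency E \<psi>"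
    by (auto simp: switching_equivalent_def)
  have "D $ u $ u \<noteq> 0" for u using D(2)[of u] by auto
  from diagonal_conjugation[OF D(1) this] show "\<exists>p. (\<forall>u. p u \<in> {1, -1, \<i>, -\<i>}) \<and>
     (\<forall>u v. hermitian_adjacency E \<psi> $ u $ v =
        inverse (p u) * hermitian_adjacency E \<phi> $ u $ v * p v)"
    using D(2) unfolding D(3)[symmetric] by (intro exI[of _ "\<lambda>u. D $ u $ u"]) blast
next
  assume "\<exists>p. (\<forall>u. p u \<in> {1, -1, \<i>, -\<i>}) \<and>
     (\<forall>u v. hermitian_adjacency E \<psi> $ u $ v =
        inverse (p u) * hermitian_adjacency E \<phi> $ u $ v * p v)"
  then obtain p where p: "\<And>u. p u \<in> {1, -1, \<i>, -\<i>}"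
    "\<And>u v. hermitian_adjacency E \<psi> $ u $ v = inverse (p u) * hermitian_adjacency E \<phi> $ u $ v * p v"
    by blast
  define D :: "complex ^ 'a ^ 'a" where "D = (\<chi> u v. if u = v then p u else 0)"
  have D: "D $ u $ v = 0" if "u \<noteq> v" for u v using that by (simp add: D_def)
  have Du: "D $ u $ u = p u" for u by (simp add: D_def)
  have "D $ u $ u \<noteq> 0" for u using p(1)[of u] by (auto simp: Du)
  from diagonal_conjugation[OF D this]
  have "(matrix_inv D ** hermitian_adjacency E \<phi> ** D) $ u $ v = hermitian_adjacency E \<psi> $ u $ v" for u v
    unfolding p(2) Du by blast
  then have "matrix_inv D ** hermitian_adjacency E \<phi> ** D = hermitian_adjacency E \<psi>"
    unfolding Finite_Cartesian_Product.vec_eq_iff by blast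
  then show "switching_equivalent E \<phi> \<psi>"
    unfolding switching_equivalent_def using D Du p(1) by (intro exI[of _ D]) auto
qed

lemma prod_arrows_fst_snd:
  assumes "distinct c"
  shows "(\<Prod>d\<in>set (arrows c). f (fst d)) = prod f (set c)"
    and "(\<Prod>d\<in>set (arrows c). f (snd d)) = prod f (set c)"
proof -
  have inj: "inj_on fst (set (arrows c))" "inj_on snd (set (arrows c))"
    using assms by (metis distinct1_rotate distinct_map map_fst_arrows map_snd_arrows)+
  have im: "fst ` set (arrows c) = set c" "snd ` set (arrows c) = set c"
    by (metis list.set_map map_fst_arrows map_snd_arrows set_rotate1)+
  show "(\<Prod>d\<in>set (arrows c). f (fst d)) = prod f (set c)"
    using prod.reindex[OF inj(1), of f] im by simp
  show "(\<Prod>d\<in>set (arrows c). f (snd d)) = prod f (set c)"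
    using prod.reindex[OF inj(2), of f] im by simp
qed

text \<open>Around a cycle, each vertex contributes its switching value once and the inverse of it once.\<close>

lemma switching_preserves_gain:
  assumes "switching_equivalent E \<phi> \<psi>" "distinct c"
  shows "gain E \<psi> c = gain E \<phi> c"
proof -
  obtain p where p: "\<And>u. p u \<in> {1, -1, \<i>, -\<i>}"
    "\<And>u v. hermitian_adjacency E \<psi> $ u $ v = inverse (p u) * hermitian_adjacency E \<phi> $ u $ v * p v"
    using assms(1) unfolding switching_equivalent_iff by blast
  have nz: "prod p (set c) \<noteq> 0"
  proof -
    have "p u \<noteq> 0" for u using p(1)[of u] by auto
    then show ?thesis by simp
  qed
  have "gain E \<psi> c = (\<Prod>d\<in>set (arrows c). inverse (p (fst d))) * gain E \<phi> c *
      (\<Prod>d\<in>set (arrows c). p (snd d))"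
    by (simp add: gain_arrows[OF assms(2)] p(2) case_prod_unfold prod.distrib)
  also have "\<dots> = inverse (prod p (set c)) * gain E \<phi> c * prod p (set c)"
    using prod_arrows_fst_snd[OF assms(2), of p] prod_arrows_fst_snd[OF assms(2), of "\<lambda>u. inverse (p u)"]
    by (simp add: prod_inversef[unfolded comp_def])
  finally show ?thesis using nz by simp
qed

text \<open>Take a largest connected vertex set \<open>S\<close> on which a potential exists. If some vertex \<open>b\<close> were
  missing, an edge from \<open>u\<close> in \<open>S\<close> to \<open>b\<close> would dictate the value at \<open>b\<close>. For any further
  edge from \<open>a\<close> in \<open>S\<close> to \<open>b\<close>, a path in \<open>S\<close> from \<open>u\<close> to \<open>a\<close> closes up through
  \<open>b\<close> to a cycle; the product around it telescopes along the path, and that it is \<open>1\<close> says that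
  the dictated value fits this edge as well. The set \<open>G\<close> keeps track of the values, so that the
  potential again consists of fourth roots of unity when the weights do.\<close>

lemma potential_exists:
  fixes E :: "'v::finite set set" and w :: "'v \<times> 'v \<Rightarrow> complex"
  assumes sg: "simple_graph E" and tc: "two_connected E"
    and wG: "\<And>d. ends d \<in> E \<Longrightarrow> w d \<in> G" and G: "1 \<in> G" "\<And>x y. x \<in> G \<Longrightarrow> y \<in> G \<Longrightarrow> x * y \<in> G" "0 \<notin> G"
    and w: "\<And>d. ends d \<in> E \<Longrightarrow> w d * w (prod.swap d) = 1"
    and cyc: "\<And>c. is_cycle E c \<Longrightarrow> prod w (set (arrows c)) = 1"
  shows "\<exists>p. (\<forall>u. p u \<in> G) \<and> (\<forall>u v. {u, v} \<in> E \<longrightarrow> w (u, v) = inverse (p u) * p v)"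
proof -
  define pot where "pot = (\<lambda>S p. induced_connected E S \<and> (\<forall>u. p u \<in> G) \<and>
    (\<forall>u\<in>S. \<forall>v\<in>S. {u, v} \<in> E \<longrightarrow> w (u, v) = inverse (p u) * p v))"
  have base: "\<exists>p. pot {v} p" for v
    unfolding pot_def induced_connected_def
    using simple_graph_edge[OF sg, of v v] G(1) by (intro exI[of _ "\<lambda>_. 1"]) auto
  have "\<exists>S. (\<exists>p. pot S p) \<and> (\<forall>T. (\<exists>p. pot T p) \<longrightarrow> card T \<le> card S)"
  proof (rule ex_has_greatest_nat)
    show "\<exists>p. pot {undefined} p" by (rule base)
    show "\<forall>T. (\<exists>p. pot T p) \<longrightarrow> card T < Suc CARD('v)" by (simp add: card_mono less_Suc_eq_le)
  qed
  then obtain S p where S: "pot S p" and max: "\<And>T q. pot T q \<Longrightarrow> card T \<le> card S" by blast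
  have con: "induced_connected E S" and pG: "\<And>u. p u \<in> G"
    and wp: "\<And>u v. u \<in> S \<Longrightarrow> v \<in> S \<Longrightarrow> {u, v} \<in> E \<Longrightarrow> w (u, v) = inverse (p u) * p v"
    using S unfolding pot_def by blast+
  have nz: "p u \<noteq> 0" for u using pG[of u] G(3) by metis
  \<comment> \<open>Along a walk within \<open>S\<close> only the potential at the two ends survives.\<close>
  have tele: "prod_list (map w (steps xs)) = inverse (p (hd xs)) * p (last xs)"
    if "xs \<noteq> []" "set xs \<subseteq> S" "ends ` set (steps xs) \<subseteq> E" for xs
    using that
  proof (induction xs rule: remdups_adj.induct)
    case (3 u v xs)
    then have IH: "prod_list (map w (steps (v # xs))) = inverse (p v) * p (last (v # xs))"
      by (cases "u = v") auto
    have uv: "w (u, v) = inverse (p u) * p v" using 3 by (intro wp) auto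
    have "w (u, v) * prod_list (map w (steps (v # xs))) = inverse (p u) * p (last (v # xs))"
      unfolding IH uv using nz[of v] by simp
    then show ?case by simp
  qed (auto simp: nz)
  have "S = UNIV"
  proof (rule ccontr)
    assume "S \<noteq> UNIV"
    moreover obtain s where "s \<in> S" using con by (auto simp: induced_connected_def)
    ultimately obtain u b where ub: "u \<in> S" "b \<notin> S" "{u, b} \<in> E"
      using two_connected_crossing_edge[OF tc] by (metis UNIV_eq_I)
    define q where "q = p(b := p u * w (u, b))"
    have key: "w (a, b) = inverse (p a) * (p u * w (u, b))" if a: "a \<in> S" "{a, b} \<in> E" for a
    proof (cases "a = u")
      case True
      then show ?thesis using nz[of u] by simp
    next
      case False
      have "(u, a) \<in> {(x, y). x \<in> S \<and> y \<in> S \<and> {x, y} \<in> E}\<^sup>*"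
        using con ub(1) a(1) by (auto simp: induced_connected_def)
      then obtain xs where xs: "simple_walk E u a xs" "set xs \<subseteq> S"
        using rtrancl_simple_walk[of u a S E] ub(1) by blast
      obtain y ys where ys: "xs = u # y # ys"
        using xs(1) False by (cases xs rule: remdups_adj.cases) (auto simp: simple_walk_def)
      have sw: "simple_walk E b a (b # xs)"
        using xs ub(2,3) by (auto simp: simple_walk_def ys insert_commute)
      have cy: "is_cycle E (b # xs)" "arrows (b # xs) = steps (b # xs) @ [(a, b)]"
        using closed_walk_cycle[OF sw] a(2) by (auto simp: insert_commute ys)
      have "prod w (set (arrows (b # xs))) = prod_list (map w (arrows (b # xs)))"
        using cy(1) by (intro prod.distinct_set_conv_list distinct_arrows) (simp add: is_cycle_arrows)
      also have "\<dots> = w (b, u) * prod_list (map w (steps xs)) * w (a, b)"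
        unfolding cy(2) by (simp add: ys)
      also have "prod_list (map w (steps xs)) = inverse (p u) * p a"
        using tele[of xs] xs by (simp add: simple_walk_def)
      finally have "w (b, u) * (inverse (p u) * p a) * w (a, b) = 1" using cyc[OF cy(1)] by simp
      then have "p u = p a * w (a, b) * w (b, u)"
        using nz by (simp add: field_simps)
      then have "p u * w (u, b) = p a * w (a, b) * (w (u, b) * w (b, u))"
        by simp
      also have "w (u, b) * w (b, u) = 1" using w[of "(u, b)"] ub(3) by simp
      finally show ?thesis using nz[of a] by (simp add: field_simps)
    qed
    have qG: "q v \<in> G" for v using pG G(2) wG[of "(u, b)"] ub(3) by (simp add: q_def)
    have qnz: "q v \<noteq> 0" for v using qG[of v] G(3) by metis
    have fwd: "w (a, b) = inverse (q a) * q b" if "a \<in> S" "{a, b} \<in> E" for a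
      using key[OF that] that(1) ub(2) by (auto simp: q_def)
    have bwd: "w (b, a) = inverse (q b) * q a" if "a \<in> S" "{a, b} \<in> E" for a
    proof -
      have "q b = q a * w (a, b)" using fwd[OF that] qnz[of a] by (simp add: field_simps)
      then have "q b * w (b, a) = q a" using w[of "(a, b)"] that(2) by (simp add: mult.assoc)
      then show ?thesis using qnz[of b] by (simp add: field_simps)
    qed
    have "w (x, y) = inverse (q x) * q y" if xy: "x \<in> insert b S" "y \<in> insert b S" and "{x, y} \<in> E" for x y
    proof -
      consider "x \<in> S" "y \<in> S" | "x \<in> S" "y = b" | "x = b" "y \<in> S" | "x = b" "y = b" using xy by blast
      then show ?thesis
      proof cases
        case 1
        then show ?thesis using wp[OF 1 that(3)] ub(2) by (auto simp: q_def)
      next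
        case 2
        then show ?thesis using fwd that(3) by simp
      next
        case 3
        then show ?thesis using bwd that(3) by (simp add: insert_commute)
      next
        case 4
        then show ?thesis using simple_graph_edge[OF sg that(3)] by simp
      qed
    qed
    then have "pot (insert b S) q"
      unfolding pot_def using induced_connected_insert[OF con ub(1) subset_refl ub(3)] qG by blast
    then have "card (insert b S) \<le> card S" by (rule max)
    then show False using ub(2) by simp
  qed
  then show ?thesis using pG wp by blast
qed

lemma prod_cycle_determined:
  fixes w :: "'a \<times> 'a \<Rightarrow> complex"
  assumes c: "distinct c" "length c \<ge> 3" and c': "distinct c'" "length c' \<ge> 3"
    and eq: "cycle_edges c = cycle_edges c'"
    and w: "\<And>d. ends d \<in> cycle_edges c \<Longrightarrow> w d * w (prod.swap d) = 1"
    and one: "prod w (set (arrows c)) = 1"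
  shows "prod w (set (arrows c')) = 1"
  using arrows_eq_or_reversed[OF c' c eq[symmetric]]
proof
  assume "set (arrows c') = set (arrows c)"
  then show ?thesis using one by simp
next
  assume sw: "set (arrows c') = prod.swap ` set (arrows c)"
  have "prod w (set (arrows c')) = (\<Prod>d\<in>set (arrows c). w (prod.swap d))"
    unfolding sw by (subst prod.reindex) (auto simp: comp_def)
  then have "prod w (set (arrows c)) * prod w (set (arrows c')) =
    (\<Prod>d\<in>set (arrows c). w d * w (prod.swap d))"
    by (simp add: prod.distrib)
  also have "\<dots> = 1" by (rule prod.neutral) (auto simp: w cycle_edges_arrows simp del: ends_pair)
  finally show ?thesis using one by simp
qed

context plane_graph begin

text \<open>The list contains every face cycle only up to reversal and choice of the first vertex. For
  weights that are inverted on reversed arrows this makes no difference.\<close>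

lemma trivial_on_listed_faces:
  fixes w :: "'v \<times> 'v \<Rightarrow> complex"
  assumes tc: "two_connected E" and Cs: "clockwise_face_cycles E pos crv Cs"
    and w: "\<And>d. ends d \<in> E \<Longrightarrow> w d * w (prod.swap d) = 1"
    and faces: "\<And>c. c \<in> set Cs \<Longrightarrow> prod w (set (arrows c)) = 1"
    and c: "is_cycle E c"
  shows "prod w (set (arrows c)) = 1"
proof (rule trivial_on_faces_trivial_on_cycles[where w = w, OF tc w _ c])
  fix b assume b: "face_cycle E pos crv b"
  then have "cycle_edges b \<in> cycle_edges ` set Cs" using Cs by (simp add: clockwise_face_cycles_def)
  then obtain b' where b': "b' \<in> set Cs" "cycle_edges b' = cycle_edges b" by auto
  then have "is_cycle E b'" "is_cycle E b"
    using Cs b by (auto simp: clockwise_face_cycles_def face_cycle_def)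
  then show "prod w (set (arrows b)) = 1"
    using b' faces w by (intro prod_cycle_determined[of b' b]) (auto simp: is_cycle_arrows)
qed

text \<open>Give the edge the weight \<open>2\<close> in one direction and \<open>1/2\<close> in the other, and all other edges the
  weight \<open>1\<close>. If the edge were on no face cycle, these weights would be trivial around all face cycles,
  but they are not trivial around a cycle that contains the edge.\<close>

lemma edge_on_face_cycle:
  assumes tc: "two_connected E" and Cs: "clockwise_face_cycles E pos crv Cs" and e: "e \<in> E"
  shows "\<exists>c\<in>set Cs. e \<in> cycle_edges c"
proof (rule ccontr)
  assume none: "\<not> ?thesis"
  obtain u v where uv: "e = {u, v}" "u \<noteq> v" using edge_pair[OF e] .
  define w :: "'v \<times> 'v \<Rightarrow> complex" where
    "w = (\<lambda>d. if d = (u, v) then 2 else if d = (v, u) then 1/2 else 1)"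
  obtain c where c: "is_cycle E c" "(u, v) \<in> set (arrows c)"
    using edge_on_cycle[OF simple tc] e uv by blast
  have "prod w (set (arrows b)) = 1" if "b \<in> set Cs" for b
  proof (rule prod.neutral, rule ballI)
    fix d assume "d \<in> set (arrows b)"
    then have "ends d \<noteq> e" using none that by (auto simp: cycle_edges_arrows simp del: ends_pair)
    then show "w d = 1" using uv by (auto simp: w_def)
  qed
  moreover have "w d * w (prod.swap d) = 1" for d using uv(2) by (cases d) (auto simp: w_def)
  ultimately have "prod w (set (arrows c)) = 1" using trivial_on_listed_faces[where w = w, OF tc Cs _ _ c(1)] by blast
  moreover have "prod w (set (arrows c)) = w (u, v) * prod w (set (arrows c) - {(u, v)})"
    using c(2) by (simp add: prod.remove)
  moreover have "prod w (set (arrows c) - {(u, v)}) = 1"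
    using arrow_not_reversed[of c u v] c by (intro prod.neutral) (auto simp: w_def is_cycle_arrows)
  ultimately show False by (simp add: w_def)
qed

text \<open>Equal gains on the face cycles make the ratio of the two Hermitian weights trivial around every
  cycle, and a potential of this ratio is a switching.\<close>

lemma switching_class_gains:
  assumes tc: "two_connected E" and Cs: "clockwise_face_cycles E pos crv Cs"
    and \<phi>: "partial_orientation E \<phi>"
  shows "switching_class E \<phi> =
    {\<psi>. partial_orientation E \<psi> \<and> (\<forall>c\<in>set Cs. gain E \<psi> c = gain E \<phi> c)}"
proof -
  have cy: "is_cycle E c" if "c \<in> set Cs" for c
    using Cs that by (auto simp: clockwise_face_cycles_def face_cycle_def)
  have "switching_equivalent E \<phi> \<psi>"
    if \<psi>: "partial_orientation E \<psi>" and g: "\<And>c. c \<in> set Cs \<Longrightarrow> gain E \<psi> c = gain E \<phi> c" for \<psi>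
  proof -
    let ?H = "\<lambda>u v. hermitian_adjacency E \<phi> $ u $ v" and ?K = "\<lambda>u v. hermitian_adjacency E \<psi> $ u $ v"
    define w where "w = (\<lambda>d. ?K (fst d) (snd d) / ?H (fst d) (snd d))"
    have w1: "w d * w (prod.swap d) = 1" if "ends d \<in> E" for d
      using hermitian_edge(3)[OF \<phi>, of "fst d" "snd d"] hermitian_edge(3)[OF \<psi>, of "fst d" "snd d"] that
      by (cases d) (simp add: w_def)
    have wG: "w d \<in> {1, -1, \<i>, -\<i>}" if "ends d \<in> E" for d
      using hermitian_edge(1)[OF \<phi>, of "fst d" "snd d"] hermitian_edge(1)[OF \<psi>, of "fst d" "snd d"] that
      by (cases d) (auto simp: w_def)
    have nz: "?H u v \<noteq> 0" if "{u, v} \<in> E" for u v using hermitian_edge(1)[OF \<phi> that] by auto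
    have "prod w (set (arrows c)) = 1" if c: "c \<in> set Cs" for c
    proof -
      have d: "distinct c" and cE: "cycle_edges c \<subseteq> E" using cy[OF c] by (auto simp: is_cycle_arrows)
      have "prod w (set (arrows c)) = gain E \<psi> c / gain E \<phi> c"
        by (simp add: gain_arrows[OF d] w_def case_prod_unfold prod_dividef)
      moreover have "gain E \<phi> c \<noteq> 0"
        using nz cE by (auto simp: gain_arrows[OF d] cycle_edges_arrows)
      ultimately show ?thesis using g[OF c] by simp
    qed
    then have "prod w (set (arrows c)) = 1" if "is_cycle E c" for c
      using trivial_on_listed_faces[where w = w, OF tc Cs w1 _ that] by blast
    then have "\<exists>p. (\<forall>u. p u \<in> {1, -1, \<i>, -\<i>}) \<and>
        (\<forall>u v. {u, v} \<in> E \<longrightarrow> w (u, v) = inverse (p u) * p v)"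
      by (intro potential_exists[where w = w, OF simple tc wG _ _ _ w1]) auto
    then obtain p where p: "\<And>u. p u \<in> {1, -1, \<i>, -\<i>}"
      "\<And>u v. {u, v} \<in> E \<Longrightarrow> w (u, v) = inverse (p u) * p v"
      by blast
    have "?K u v = inverse (p u) * ?H u v * p v" for u v
    proof (cases "{u, v} \<in> E")
      case True
      then show ?thesis using p(2)[OF True] nz[OF True] by (simp add: w_def field_simps)
    qed (simp add: hermitian_non_edge)
    then show ?thesis unfolding switching_equivalent_iff using p(1) by blast
  qed
  moreover have "gain E \<psi> c = gain E \<phi> c" if "switching_equivalent E \<phi> \<psi>" "c \<in> set Cs" for \<psi> c
    using switching_preserves_gain[OF that(1)] cy[OF that(2)] by (simp add: is_cycle_arrows)
  ultimately show ?thesis unfolding switching_class_def by blast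
qed

end

section \<open>Counting labelings and orientations\<close>

text \<open>A labeling of a disjoint union amounts to an independent choice of a labeling of each block.\<close>

lemma card_labelings_of_disjoint_blocks:
  fixes A :: "'i \<Rightarrow> 'e set" and x :: "'i \<Rightarrow> 'a::comm_monoid_mult"
  assumes I: "finite I" and disj: "\<And>i j. i \<in> I \<Longrightarrow> j \<in> I \<Longrightarrow> i \<noteq> j \<Longrightarrow> A i \<inter> A j = {}"
  shows "card {f \<in> (\<Union>i\<in>I. A i) \<rightarrow>\<^sub>E B. \<forall>i\<in>I. prod f (A i) = x i} =
    (\<Prod>i\<in>I. card {f \<in> A i \<rightarrow>\<^sub>E B. prod f (A i) = x i})"
proof -
  let ?L = "{f \<in> (\<Union>i\<in>I. A i) \<rightarrow>\<^sub>E B. \<forall>i\<in>I. prod f (A i) = x i}"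
  let ?R = "PiE I (\<lambda>i. {f \<in> A i \<rightarrow>\<^sub>E B. prod f (A i) = x i})"
  define split :: "('e \<Rightarrow> 'a) \<Rightarrow> 'i \<Rightarrow> 'e \<Rightarrow> 'a" where "split = (\<lambda>f. \<lambda>i\<in>I. restrict f (A i))"
  define glue :: "('i \<Rightarrow> 'e \<Rightarrow> 'a) \<Rightarrow> 'e \<Rightarrow> 'a" where "glue = (\<lambda>g. \<lambda>e\<in>(\<Union>i\<in>I. A i). g (THE i. i \<in> I \<and> e \<in> A i) e)"
  have the: "(THE i. i \<in> I \<and> e \<in> A i) = i" if "i \<in> I" "e \<in> A i" for i e
    using that disj by (intro the_equality) auto
  have glue_eq: "glue g e = g i e" if "i \<in> I" "e \<in> A i" for g i e
    using that by (auto simp: glue_def the)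
  have "bij_betw split ?L ?R"
  proof (rule bij_betw_byWitness[where f' = glue])
    show "\<forall>f\<in>?L. glue (split f) = f"
    proof
      fix f assume f: "f \<in> ?L"
      have "glue (split f) e = f e" for e
      proof (cases "e \<in> (\<Union>i\<in>I. A i)")
        case True
        then obtain i where "i \<in> I" "e \<in> A i" by blast
        then show ?thesis by (simp add: glue_eq split_def)
      next
        case False
        then show ?thesis using f by (auto simp: glue_def PiE_def extensional_def)
      qed
      then show "glue (split f) = f" by (rule ext)
    qed
    show "\<forall>g\<in>?R. split (glue g) = g"
    proof
      fix g assume g: "g \<in> ?R"
      have "split (glue g) i = g i" for i
      proof (cases "i \<in> I")
        case True
        then have gi: "g i \<in> extensional (A i)" using g by (auto simp: PiE_def Pi_def)
        have "restrict (glue g) (A i) e = g i e" for e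
          using glue_eq[OF True] gi by (cases "e \<in> A i") (auto simp: extensional_def)
        then show ?thesis using True by (auto simp: split_def)
      next
        case False
        then show ?thesis using g by (auto simp: split_def PiE_def extensional_def)
      qed
      then show "split (glue g) = g" by (rule ext)
    qed
    show "split ` ?L \<subseteq> ?R"
      by (fastforce simp: split_def PiE_def Pi_def)
    show "glue ` ?R \<subseteq> ?L"
    proof (rule image_subsetI)
      fix g assume g: "g \<in> ?R"
      have "glue g e \<in> B" if "i \<in> I" "e \<in> A i" for i e
        using g that by (auto simp: glue_eq PiE_def Pi_def)
      moreover have "prod (glue g) (A i) = x i" if "i \<in> I" for i
      proof -
        have "prod (glue g) (A i) = prod (g i) (A i)" using glue_eq that by (intro prod.cong) auto
        then show ?thesis using g that by (auto simp: PiE_def Pi_def)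
      qed
      moreover have "glue g \<in> extensional (\<Union>i\<in>I. A i)" by (simp add: glue_def)
      ultimately show "glue g \<in> ?L" by (auto simp: PiE_def Pi_def)
    qed
  qed
  then have "card ?L = card ?R" by (rule bij_betw_same_card)
  then show ?thesis using I by (simp add: card_PiE)
qed

text \<open>An enumeration of the set turns labelings into the lists counted by \<open>alpha\<close>.\<close>

lemma card_labelings_alpha:
  assumes "finite A"
  shows "card {f \<in> A \<rightarrow>\<^sub>E {1, \<i>, -\<i>}. prod f A = x} = alpha x (card A)"
proof -
  obtain xs where xs: "set xs = A" "distinct xs" using finite_distinct_list[OF assms] by blast
  let ?L = "{f \<in> A \<rightarrow>\<^sub>E {1, \<i>, -\<i>}. prod f A = x}"
  let ?R = "{zs. length zs = card A \<and> set zs \<subseteq> {1, \<i>, -\<i>} \<and> prod_list zs = x}"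
  have len: "length xs = card A" using distinct_card[OF xs(2)] xs(1) by simp
  have pr: "prod_list (map f xs) = prod f A" for f :: "'a \<Rightarrow> complex"
    using prod.distinct_set_conv_list[OF xs(2), of f] xs(1) by simp
  have "bij_betw (\<lambda>f. map f xs) ?L ?R"
    unfolding bij_betw_def
  proof
    show "inj_on (\<lambda>f. map f xs) ?L"
    proof (rule inj_onI)
      fix f g assume fg: "f \<in> ?L" "g \<in> ?L" "map f xs = map g xs"
      have "f e = g e" if "e \<in> A" for e using fg(3) that xs(1) by (metis map_eq_conv)
      moreover have "f \<in> A \<rightarrow>\<^sub>E {1, \<i>, -\<i>}" "g \<in> A \<rightarrow>\<^sub>E {1, \<i>, -\<i>}" using fg by blast+
      ultimately show "f = g" by (metis PiE_ext)
    qed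
    show "(\<lambda>f. map f xs) ` ?L = ?R"
    proof
      show "(\<lambda>f. map f xs) ` ?L \<subseteq> ?R" using len pr xs(1) by auto
      show "?R \<subseteq> (\<lambda>f. map f xs) ` ?L"
      proof
        fix zs assume zs: "zs \<in> ?R"
        define f where "f = (\<lambda>e\<in>A. the (map_of (zip xs zs) e))"
        have fz: "map f xs = zs"
        proof (rule nth_equalityI)
          show "length (map f xs) = length zs" using zs len by simp
          fix i assume "i < length (map f xs)"
          then have i: "i < length xs" by simp
          then have "map_of (zip xs zs) (xs ! i) = Some (zs ! i)"
            using zs len xs(2) by (intro map_of_zip_nth) auto
          then show "map f xs ! i = zs ! i" using i xs(1) by (auto simp: f_def)
        qed
        have "f ` A = set zs" using fz xs(1) by (metis list.set_map)
        then have "f \<in> ?L" using zs pr[of f] fz by (auto simp: f_def PiE_def)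
        then show "zs \<in> (\<lambda>f. map f xs) ` ?L" using fz by blast
      qed
    qed
  qed
  then show ?thesis unfolding alpha_def by (rule bij_betw_same_card)
qed

text \<open>Once every edge \<open>e\<close> has a reference direction \<open>r e\<close>, the Hermitian weight along it tells
  whether \<open>e\<close> is undirected, directed along \<open>r e\<close>, or directed against it.\<close>

lemma bij_orientation_labeling:
  assumes sg: "simple_graph E" and r: "\<And>e. e \<in> E \<Longrightarrow> ends (r e) = e"
  shows "bij_betw (\<lambda>\<psi>. \<lambda>e\<in>E. hermitian_adjacency E \<psi> $ fst (r e) $ snd (r e))
    {\<psi>. partial_orientation E \<psi>} (E \<rightarrow>\<^sub>E {1, \<i>, -\<i>})"
  (is "bij_betw ?F ?L ?R")
  unfolding bij_betw_def
proof
  have rE: "r {u, v} = (u, v) \<or> r {u, v} = (v, u)" if "{u, v} \<in> E" for u v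
    using r[OF that] by (cases "r {u, v}") (auto simp: doubleton_eq_iff)
  show "inj_on ?F ?L"
  proof (rule inj_onI)
    fix \<psi> \<psi>' assume p: "\<psi> \<in> ?L" "\<psi>' \<in> ?L" and eq: "?F \<psi> = ?F \<psi>'"
    have iff: "(u, v) \<in> \<psi> \<longleftrightarrow> (u, v) \<in> \<psi>'" for u v
    proof (cases "{u, v} \<in> E")
      case True
      then have "hermitian_adjacency E \<psi> $ fst (r {u, v}) $ snd (r {u, v}) =
        hermitian_adjacency E \<psi>' $ fst (r {u, v}) $ snd (r {u, v})"
        using fun_cong[OF eq, of "{u, v}"] by simp
      then show ?thesis
        using rE[OF True] True p
        by (auto simp: hermitian_adjacency_def partial_orientation_def insert_commute complex_eq_iff split: if_splits)
    next
      case False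
      then show ?thesis using p by (auto simp: partial_orientation_def)
    qed
    then show "\<psi> = \<psi>'" by auto
  qed
  show "?F ` ?L = ?R"
  proof
    show "?F ` ?L \<subseteq> ?R"
      by (auto simp: hermitian_adjacency_def split: if_splits)
        (metis ends_def r)+
    show "?R \<subseteq> ?F ` ?L"
    proof
      fix f assume f: "f \<in> ?R"
      define \<psi> where "\<psi> = {(u, v). {u, v} \<in> E \<and>
        (r {u, v} = (u, v) \<and> f {u, v} = \<i> \<or> r {u, v} = (v, u) \<and> f {u, v} = -\<i>)}"
      have "\<psi> \<in> ?L"
        using simple_graph_edge[OF sg]
        by (auto simp: \<psi>_def partial_orientation_def insert_commute complex_eq_iff)
      moreover have "?F \<psi> e = f e" for e
      proof (cases "e \<in> E")
        case True
        obtain u v where uv: "r e = (u, v)" by (cases "r e")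
        then have e: "e = {u, v}" using r[OF True] by simp
        have "u \<noteq> v" using simple_graph_edge[OF sg] True e by blast
        moreover have "f e \<in> {1, \<i>, -\<i>}" using f True by auto
        ultimately show ?thesis
          using True uv
          by (auto simp: e hermitian_adjacency_def \<psi>_def insert_commute complex_eq_iff)
      next
        case False
        then show ?thesis using f by (auto simp: PiE_def extensional_def)
      qed
      then have "?F \<psi> = f" by (rule ext)
      ultimately show "f \<in> ?F ` ?L" by (metis (no_types, lifting) image_eqI)
    qed
  qed
qed

section \<open>Counting orientations with given gains around the cycles of a cover\<close>

text \<open>All that the count uses of the face cycles: every edge lies on some cycle of the list, and no arrow
  lies on two of them. As an edge has just two arrows, it lies on at most two cycles, with opposite
  directions.\<close>

locale directed_cycle_cover =
  fixes E :: "'v::finite set set" and Cs :: "'v list list"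
  assumes simple: "simple_graph E"
    and cycles: "\<And>c. c \<in> set Cs \<Longrightarrow> is_cycle E c"
    and once: "\<And>p q. p < length Cs \<Longrightarrow> q < length Cs \<Longrightarrow> p \<noteq> q \<Longrightarrow>
      set (arrows (Cs ! p)) \<inter> set (arrows (Cs ! q)) = {}"
    and cover: "\<And>e. e \<in> E \<Longrightarrow> \<exists>c\<in>set Cs. e \<in> cycle_edges c"
begin

abbreviation "k \<equiv> length Cs"

definition faces_at :: "'v set \<Rightarrow> nat set" where
  "faces_at e = {p. p < k \<and> e \<in> cycle_edges (Cs ! p)}"

definition arrow_at :: "nat \<Rightarrow> 'v set \<Rightarrow> 'v \<times> 'v" where
  "arrow_at p e = inv_into (set (arrows (Cs ! p))) ends e"

lemma cycle_nth: "p < k \<Longrightarrow> is_cycle E (Cs ! p)"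
  by (simp add: cycles)

lemma faces_atD: "p \<in> faces_at e \<Longrightarrow> p < k \<and> e \<in> cycle_edges (Cs ! p)"
  by (simp add: faces_at_def)

lemma arrow_at:
  assumes "p \<in> faces_at e"
  shows "arrow_at p e \<in> set (arrows (Cs ! p))" "ends (arrow_at p e) = e"
proof -
  have e: "e \<in> ends ` set (arrows (Cs ! p))"
    using faces_atD[OF assms] by (simp add: cycle_edges_arrows)
  show "arrow_at p e \<in> set (arrows (Cs ! p))" unfolding arrow_at_def by (rule inv_into_into[OF e])
  show "ends (arrow_at p e) = e" unfolding arrow_at_def by (rule f_inv_into_f[OF e])
qed

lemma arrow_at_other:
  assumes "p \<in> faces_at e" "q \<in> faces_at e" "p \<noteq> q"
  shows "arrow_at q e = prod.swap (arrow_at p e)"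
proof -
  have "ends (arrow_at q e) = ends (arrow_at p e)" using assms by (simp add: arrow_at)
  moreover have "arrow_at q e \<noteq> arrow_at p e"
    using arrow_at(1)[OF assms(1)] arrow_at(1)[OF assms(2)] once[of p q] assms faces_atD by fastforce
  ultimately show ?thesis by (simp add: ends_eq_iff)
qed

lemma at_most_two_faces:
  assumes "p \<in> faces_at e" "q \<in> faces_at e" "r \<in> faces_at e" "p \<noteq> q" "p \<noteq> r"
  shows "q = r"
proof (rule ccontr)
  assume "q \<noteq> r"
  moreover have "arrow_at q e = arrow_at r e"
    using arrow_at_other[of p e q] arrow_at_other[of p e r] assms by simp
  ultimately show False
    using arrow_at(1)[OF assms(2)] arrow_at(1)[OF assms(3)] once[of q r] faces_atD assms by fastforce
qed

text \<open>This treats the edges on a single cycle, the case \<open>p = q\<close>, like the others: a block of the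
  partition consists of the edges with a given set of incident faces.\<close>

lemma shared_edges_iff:
  assumes "p < k" "q < k"
  shows "e \<in> shared_edges Cs p q \<longleftrightarrow> faces_at e = {p, q}"
proof (cases "p = q")
  case True
  then show ?thesis using assms by (auto simp: shared_edges_def faces_at_def)
next
  case False
  have "e \<in> shared_edges Cs p q \<longleftrightarrow> p \<in> faces_at e \<and> q \<in> faces_at e"
    using False assms by (auto simp: shared_edges_def faces_at_def)
  also have "\<dots> \<longleftrightarrow> faces_at e = {p, q}"
    using at_most_two_faces[of p e q] False by blast
  finally show ?thesis .
qed

lemma shared_edges_commute: "shared_edges Cs p q = shared_edges Cs q p"
  by (auto simp: shared_edges_def)

lemma num_shared_commute: "num_shared Cs p q = num_shared Cs q p"
  by (simp add: num_shared_def shared_edges_commute)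

lemma num_shared_eq_0: "num_shared Cs p q = 0 \<longleftrightarrow> shared_edges Cs p q = {}"
  by (simp add: num_shared_def)

lemma shared_edges_subset:
  assumes "p < k"
  shows "shared_edges Cs p q \<subseteq> cycle_edges (Cs ! p)" "shared_edges Cs p q \<subseteq> E"
proof -
  show "shared_edges Cs p q \<subseteq> cycle_edges (Cs ! p)" by (auto simp: shared_edges_def)
  then show "shared_edges Cs p q \<subseteq> E" using cycle_nth[OF assms] by (auto simp: is_cycle_arrows)
qed

lemma faces_at_edge:
  assumes "e \<in> E"
  shows "\<exists>p q. p \<le> q \<and> q < k \<and> faces_at e = {p, q}"
proof -
  obtain c where "c \<in> set Cs" "e \<in> cycle_edges c" using cover[OF assms] by blast
  then obtain p where p: "p \<in> faces_at e" by (auto simp: faces_at_def in_set_conv_nth)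
  show ?thesis
  proof (cases "\<exists>q\<in>faces_at e. q \<noteq> p")
    case True
    then obtain q where q: "q \<in> faces_at e" "q \<noteq> p" by blast
    then have eq: "faces_at e = {p, q}" using p at_most_two_faces[of p e q] by blast
    then have "faces_at e = {min p q, max p q}" by (auto simp: min_def max_def)
    moreover have "max p q < k" using p q faces_atD by auto
    ultimately show ?thesis by (intro exI[of _ "min p q"] exI[of _ "max p q"]) auto
  next
    case False
    then have "faces_at e = {p, p}" using p by blast
    then show ?thesis using faces_atD[OF p] by blast
  qed
qed

definition blocks :: "(nat \<times> nat) set" where
  "blocks = {(p, q). p \<le> q \<and> q < k \<and> num_shared Cs p q \<noteq> 0}"

abbreviation block :: "nat \<times> nat \<Rightarrow> 'v set set" where
  "block \<equiv> case_prod (shared_edges Cs)"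

lemma finite_blocks: "finite blocks"
  by (rule finite_subset[of _ "{..<k} \<times> {..<k}"]) (auto simp: blocks_def)

lemma edges_partition: "E = (\<Union>i\<in>blocks. block i)"
proof
  show "E \<subseteq> (\<Union>i\<in>blocks. block i)"
  proof
    fix e assume "e \<in> E"
    from faces_at_edge[OF this] obtain p q where pq: "p \<le> q" "q < k" "faces_at e = {p, q}" by blast
    then have "e \<in> shared_edges Cs p q" by (simp add: shared_edges_iff)
    moreover from this have "(p, q) \<in> blocks"
      using pq num_shared_eq_0[of p q] by (auto simp: blocks_def)
    ultimately show "e \<in> (\<Union>i\<in>blocks. block i)" by (intro UN_I[of "(p, q)"]) auto
  qed
  show "(\<Union>i\<in>blocks. block i) \<subseteq> E"
  proof (rule UN_least)
    fix i assume "i \<in> blocks"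
    then show "block i \<subseteq> E" using shared_edges_subset(2) by (cases i) (auto simp: blocks_def)
  qed
qed

lemma blocks_disjoint:
  assumes "i \<in> blocks" "j \<in> blocks" "i \<noteq> j"
  shows "block i \<inter> block j = {}"
proof (rule ccontr)
  assume "\<not> ?thesis"
  then obtain e where e: "e \<in> block i" "e \<in> block j" by blast
  obtain p q p' q' where ij: "i = (p, q)" "j = (p', q')" by (cases i; cases j)
  have "{p, q} = {p', q'}"
    using e assms(1,2) shared_edges_iff by (simp add: ij blocks_def)
  then show False using assms by (auto simp: ij blocks_def doubleton_eq_iff)
qed

lemma cycle_partition:
  assumes "p < k"
  shows "cycle_edges (Cs ! p) = (\<Union>q\<in>{q. q < k \<and> num_shared Cs p q \<noteq> 0}. shared_edges Cs p q)"
proof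
  show "cycle_edges (Cs ! p) \<subseteq> (\<Union>q\<in>{q. q < k \<and> num_shared Cs p q \<noteq> 0}. shared_edges Cs p q)"
  proof
    fix e assume e: "e \<in> cycle_edges (Cs ! p)"
    then have p: "p \<in> faces_at e" using assms by (simp add: faces_at_def)
    have "e \<in> E" using e cycle_nth[OF assms] by (auto simp: is_cycle_arrows)
    from faces_at_edge[OF this] obtain a b where ab: "a \<le> b" "b < k" "faces_at e = {a, b}" by blast
    then consider "p = a" | "p = b" using p by blast
    then obtain q where q: "q < k" "faces_at e = {p, q}"
    proof cases
      case 1
      then show ?thesis using ab that[of b] by simp
    next
      case 2
      then show ?thesis using ab that[of a] by (simp add: insert_commute)
    qed
    then have "e \<in> shared_edges Cs p q" using assms by (simp add: shared_edges_iff)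
    then show "e \<in> (\<Union>q\<in>{q. q < k \<and> num_shared Cs p q \<noteq> 0}. shared_edges Cs p q)"
      using q num_shared_eq_0[of p q] by blast
  qed
  show "(\<Union>q\<in>{q. q < k \<and> num_shared Cs p q \<noteq> 0}. shared_edges Cs p q) \<subseteq> cycle_edges (Cs ! p)"
    using shared_edges_subset(1)[OF assms] by blast
qed

lemma cycle_blocks_disjoint:
  assumes "p < k" "q < k" "r < k" "q \<noteq> r"
  shows "shared_edges Cs p q \<inter> shared_edges Cs p r = {}"
  using assms by (auto simp: shared_edges_iff doubleton_eq_iff)

text \<open>Each edge is read in the direction of the first face on it, so that the labels appear in the gain
  of that face as they are, and in the gain of the second face conjugated.\<close>

definition reference :: "'v set \<Rightarrow> 'v \<times> 'v" where
  "reference e = arrow_at (Min (faces_at e)) e"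

definition labeling :: "('v \<times> 'v) set \<Rightarrow> 'v set \<Rightarrow> complex" where
  "labeling \<psi> = (\<lambda>e\<in>E. hermitian_adjacency E \<psi> $ fst (reference e) $ snd (reference e))"

definition face_matrix :: "('v set \<Rightarrow> complex) \<Rightarrow> complex mat" where
  "face_matrix f = mat k k (\<lambda>(p, q). if num_shared Cs p q = 0 then 0
     else if p \<le> q then prod f (shared_edges Cs p q) else cnj (prod f (shared_edges Cs p q)))"

lemma ends_reference: "e \<in> E \<Longrightarrow> ends (reference e) = e"
proof -
  assume "e \<in> E"
  then obtain p q where "faces_at e = {p, q}" using faces_at_edge by blast
  then have "Min (faces_at e) \<in> faces_at e" by (intro Min_in) auto
  then show ?thesis by (simp add: reference_def arrow_at(2))
qed

text \<open>The edges of a cycle are the disjoint union of the blocks that it shares with the cycles \<open>q\<close>. For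
  \<open>p \<le> q\<close> the cycle \<open>p\<close> traverses the block in the reference direction; for \<open>p > q\<close> it
  traverses it backwards, which conjugates the weights.\<close>

lemma gain_face_matrix:
  assumes \<psi>: "partial_orientation E \<psi>" and p: "p < k"
  shows "gain E \<psi> (Cs ! p) =
    (\<Prod>q | q < k \<and> num_shared Cs p q \<noteq> 0. face_matrix (labeling \<psi>) $$ (p, q))"
proof -
  let ?h = "\<lambda>d. hermitian_adjacency E \<psi> $ fst d $ snd d"
  let ?Q = "{q. q < k \<and> num_shared Cs p q \<noteq> 0}"
  have c: "distinct (Cs ! p)" "length (Cs ! p) \<ge> 3" "cycle_edges (Cs ! p) \<subseteq> E"
    using cycle_nth[OF p] by (auto simp: is_cycle_arrows)
  have inj: "inj_on ends (set (arrows (Cs ! p)))" by (rule inj_on_ends_arrows[OF c(1,2)])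
  have block: "(\<Prod>e\<in>shared_edges Cs p q. ?h (arrow_at p e)) = face_matrix (labeling \<psi>) $$ (p, q)"
    if q: "q \<in> ?Q" for q
  proof -
    have fe: "faces_at e = {p, q}" "e \<in> E" if "e \<in> shared_edges Cs p q" for e
    proof -
      show "faces_at e = {p, q}" using that shared_edges_iff[OF p, of q] q by simp
      show "e \<in> E" using that shared_edges_subset(2)[OF p] by blast
    qed
    show ?thesis
    proof (cases "p \<le> q")
      case True
      have "?h (arrow_at p e) = labeling \<psi> e" if "e \<in> shared_edges Cs p q" for e
        using fe[OF that] True by (simp add: labeling_def reference_def)
      then have "(\<Prod>e\<in>shared_edges Cs p q. ?h (arrow_at p e)) = prod (labeling \<psi>) (shared_edges Cs p q)"
        by (intro prod.cong) auto
      then show ?thesis using True p q by (simp add: face_matrix_def)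
    next
      case False
      have "?h (arrow_at p e) = cnj (labeling \<psi> e)" if e: "e \<in> shared_edges Cs p q" for e
      proof -
        have "arrow_at p e = prod.swap (arrow_at q e)"
          using fe(1)[OF e] False by (intro arrow_at_other) auto
        moreover have "ends (arrow_at q e) = e" using fe(1)[OF e] by (intro arrow_at) auto
        then have "{fst (arrow_at q e), snd (arrow_at q e)} \<in> E" using fe(2)[OF e] by (simp add: ends_def)
        from hermitian_edge(2)[OF \<psi> this]
        have "?h (prod.swap (arrow_at q e)) = cnj (?h (arrow_at q e))" by simp
        moreover have "labeling \<psi> e = ?h (arrow_at q e)"
          using fe[OF e] False by (simp add: labeling_def reference_def)
        ultimately show ?thesis by simp
      qed
      then have "(\<Prod>e\<in>shared_edges Cs p q. ?h (arrow_at p e)) =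
          (\<Prod>e\<in>shared_edges Cs p q. cnj (labeling \<psi> e))"
        by (intro prod.cong) auto
      then show ?thesis using False p q by (simp add: face_matrix_def)
    qed
  qed
  have "gain E \<psi> (Cs ! p) = prod ?h (set (arrows (Cs ! p)))"
    by (simp add: gain_arrows[OF c(1)] case_prod_unfold)
  also have "\<dots> = (\<Prod>e\<in>cycle_edges (Cs ! p). ?h (arrow_at p e))"
    unfolding cycle_edges_arrows prod.reindex[OF inj] comp_def
    by (intro prod.cong) (auto simp: arrow_at_def inv_into_f_f[OF inj] simp del: ends_pair)
  also have "\<dots> = (\<Prod>q\<in>?Q. \<Prod>e\<in>shared_edges Cs p q. ?h (arrow_at p e))"
    unfolding cycle_partition[OF p] using cycle_blocks_disjoint[OF p]
    by (intro prod.UNION_disjoint) auto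
  also have "\<dots> = (\<Prod>q\<in>?Q. face_matrix (labeling \<psi>) $$ (p, q))"
    by (rule prod.cong) (auto simp: block)
  finally show ?thesis .
qed

text \<open>The conditions on the single entries hold for every labeling: a block with one edge only allows
  the three labels, a larger one at least gives a product of fourth roots of unity, and the matrix is
  Hermitian off the diagonal by construction. Only the row products are a restriction.\<close>

lemma face_matrix_in_Gamma_iff:
  assumes f: "f \<in> E \<rightarrow>\<^sub>E {1, \<i>, -\<i>}"
  shows "face_matrix f \<in> Gamma_set Cs y \<longleftrightarrow>
    (\<forall>p<k. (\<Prod>q | q < k \<and> num_shared Cs p q \<noteq> 0. face_matrix f $$ (p, q)) = y ! p)"
proof -
  have val: "f e \<in> {1, \<i>, -\<i>}" if "p < k" "e \<in> shared_edges Cs p q" for e p q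
    using f shared_edges_subset(2)[of p q] that by auto
  have one: "face_matrix f $$ (p, q) \<in> {1, \<i>, -\<i>}" if pq: "p < k" "q < k" "num_shared Cs p q = 1" for p q
  proof -
    obtain e where e: "shared_edges Cs p q = {e}"
      using pq(3) by (auto simp: num_shared_def card_1_singleton_iff)
    then have "f e \<in> {1, \<i>, -\<i>}" using val[OF pq(1)] by blast
    then show ?thesis using pq e by (auto simp: face_matrix_def)
  qed
  have prods: "prod f A \<in> {1, -1, \<i>, -\<i>}" if "\<And>e. e \<in> A \<Longrightarrow> f e \<in> {1, \<i>, -\<i>}" for A
    using that by (induction A rule: infinite_finite_induct) force+
  have many: "face_matrix f $$ (p, q) \<in> {1, -1, \<i>, -\<i>}"
    if pq: "p < k" "q < k" "num_shared Cs p q > 1" for p q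
  proof -
    define z where "z = prod f (shared_edges Cs p q)"
    have "z \<in> {1, -1, \<i>, -\<i>}" unfolding z_def by (rule prods[OF val[OF pq(1)]])
    moreover have "face_matrix f $$ (p, q) = z \<or> face_matrix f $$ (p, q) = cnj z"
      using pq by (simp add: face_matrix_def z_def)
    ultimately show ?thesis by auto
  qed
  have "face_matrix f $$ (p, q) = cnj (face_matrix f $$ (q, p))" if "p < k" "q < k" "p \<noteq> q" for p q
    using that num_shared_commute[of p q] shared_edges_commute[of p q] by (auto simp: face_matrix_def)
  moreover have "face_matrix f $$ (p, q) = 0" if "p < k" "q < k" "num_shared Cs p q = 0" for p q
    using that by (simp add: face_matrix_def)
  moreover have "face_matrix f \<in> carrier_mat k k" by (simp add: face_matrix_def)
  ultimately have "face_matrix f \<in> carrier_mat k k"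
    "\<forall>p<k. \<forall>q<k. (num_shared Cs p q = 0 \<longrightarrow> face_matrix f $$ (p, q) = 0) \<and>
      (num_shared Cs p q = 1 \<longrightarrow> face_matrix f $$ (p, q) \<in> {1, \<i>, -\<i>}) \<and>
      (num_shared Cs p q > 1 \<longrightarrow> face_matrix f $$ (p, q) \<in> {1, -1, \<i>, -\<i>})"
    "\<forall>p<k. \<forall>q<k. p \<noteq> q \<longrightarrow> face_matrix f $$ (p, q) = cnj (face_matrix f $$ (q, p))"
    using one many by blast+
  note entries = this
  \<comment> \<open>Of the conditions of \<open>Gamma_set\<close>, only the one on row products remains.\<close>
  have "(P \<and> Q \<and> S \<and> R) = S" if P Q R for P Q R S using that by blast
  from this[OF entries] show ?thesis unfolding Gamma_set_def mem_Collect_eq .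
qed

text \<open>Both matrices vanish at empty blocks and are Hermitian off the diagonal, so the entries at the
  blocks, which lie on or above the diagonal, decide.\<close>

lemma face_matrix_eq_iff:
  assumes X: "X \<in> Gamma_set Cs y"
  shows "face_matrix f = X \<longleftrightarrow> (\<forall>i\<in>blocks. prod f (block i) = X $$ i)"
proof
  assume "face_matrix f = X"
  then show "\<forall>i\<in>blocks. prod f (block i) = X $$ i"
    by (auto simp: face_matrix_def blocks_def)
next
  assume eq: "\<forall>i\<in>blocks. prod f (block i) = X $$ i"
  have car: "X \<in> carrier_mat k k"
    and zero: "\<And>p q. p < k \<Longrightarrow> q < k \<Longrightarrow> num_shared Cs p q = 0 \<Longrightarrow> X $$ (p, q) = 0"
    and herm: "\<And>p q. p < k \<Longrightarrow> q < k \<Longrightarrow> p \<noteq> q \<Longrightarrow> X $$ (p, q) = cnj (X $$ (q, p))"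
    using X unfolding Gamma_set_def by blast+
  have upper: "prod f (shared_edges Cs p q) = X $$ (p, q)"
    if "p \<le> q" "q < k" "num_shared Cs p q \<noteq> 0" for p q
    using bspec[OF eq, of "(p, q)"] that by (simp add: blocks_def)
  show "face_matrix f = X"
  proof (rule eq_matI)
    fix p q assume "p < dim_row X" "q < dim_col X"
    then have pq: "p < k" "q < k" using car by auto
    show "face_matrix f $$ (p, q) = X $$ (p, q)"
    proof (cases "num_shared Cs p q = 0")
      case True
      then show ?thesis using zero[OF pq] pq by (simp add: face_matrix_def)
    next
      case False
      show ?thesis
      proof (cases "p \<le> q")
        case True
        then show ?thesis using upper[OF True] pq False by (simp add: face_matrix_def)
      next
        case le: False
        have "face_matrix f $$ (p, q) = cnj (prod f (shared_edges Cs q p))"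
          using pq False le shared_edges_commute[of p q] by (simp add: face_matrix_def)
        also have "\<dots> = cnj (X $$ (q, p))"
          using upper[of q p] pq False le num_shared_commute[of p q] by simp
        also have "\<dots> = X $$ (p, q)" using herm[OF pq] le by simp
        finally show ?thesis .
      qed
    qed
  qed (use car in \<open>auto simp: face_matrix_def\<close>)
qed

lemma finite_Gamma_set: "finite (Gamma_set Cs y)"
proof (rule finite_subset)
  let ?I = "{..<k} \<times> {..<k}" and ?V = "{0, 1, -1, \<i>, -\<i>} :: complex set"
  show "finite (mat k k ` (?I \<rightarrow>\<^sub>E ?V))" by (intro finite_imageI finite_PiE) auto
  show "Gamma_set Cs y \<subseteq> mat k k ` (?I \<rightarrow>\<^sub>E ?V)"
  proof
    fix X assume X: "X \<in> Gamma_set Cs y"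
    have car: "X \<in> carrier_mat k k"
      and vals: "\<And>p q. p < k \<Longrightarrow> q < k \<Longrightarrow> (num_shared Cs p q = 0 \<longrightarrow> X $$ (p, q) = 0) \<and>
        (num_shared Cs p q = 1 \<longrightarrow> X $$ (p, q) \<in> {1, \<i>, -\<i>}) \<and>
        (num_shared Cs p q > 1 \<longrightarrow> X $$ (p, q) \<in> {1, -1, \<i>, -\<i>})"
      using X unfolding Gamma_set_def by blast+
    have "X $$ (p, q) \<in> ?V" if "p < k" "q < k" for p q
    proof -
      consider "num_shared Cs p q = 0" | "num_shared Cs p q = 1" | "num_shared Cs p q > 1" by linarith
      then show ?thesis using vals[OF that] by cases auto
    qed
    then have "restrict (\<lambda>i. X $$ i) ?I \<in> ?I \<rightarrow>\<^sub>E ?V" by auto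
    moreover have "X = mat k k (restrict (\<lambda>i. X $$ i) ?I)"
      using car by (intro eq_matI) auto
    ultimately show "X \<in> mat k k ` (?I \<rightarrow>\<^sub>E ?V)" by blast
  qed
qed

lemma card_orientations_with_gains:
  "card {\<psi>. partial_orientation E \<psi> \<and> (\<forall>p<k. gain E \<psi> (Cs ! p) = y ! p)} =
    (\<Sum>X\<in>Gamma_set Cs y. \<Prod>(p, q)\<in>blocks. alpha (X $$ (p, q)) (num_shared Cs p q))"
proof -
  let ?B = "{1, \<i>, -\<i>} :: complex set"
  let ?L = "{f \<in> E \<rightarrow>\<^sub>E ?B. face_matrix f \<in> Gamma_set Cs y}"
  have bij: "bij_betw labeling {\<psi>. partial_orientation E \<psi>} (E \<rightarrow>\<^sub>E ?B)"
    using bij_orientation_labeling[OF simple ends_reference] unfolding labeling_def[abs_def] .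
  have lab: "labeling \<psi> \<in> E \<rightarrow>\<^sub>E ?B" if "partial_orientation E \<psi>" for \<psi>
    using bij_betwE[OF bij] that by blast
  have gains: "(\<forall>p<k. gain E \<psi> (Cs ! p) = y ! p) \<longleftrightarrow> face_matrix (labeling \<psi>) \<in> Gamma_set Cs y"
    if "partial_orientation E \<psi>" for \<psi>
    using face_matrix_in_Gamma_iff[OF lab[OF that]] gain_face_matrix[OF that] by simp
  have "bij_betw labeling {\<psi>. partial_orientation E \<psi> \<and> (\<forall>p<k. gain E \<psi> (Cs ! p) = y ! p)} ?L"
  proof (rule bij_betw_subset[OF bij])
    show "labeling ` {\<psi>. partial_orientation E \<psi> \<and> (\<forall>p<k. gain E \<psi> (Cs ! p) = y ! p)} = ?L"
    proof
      show "labeling ` {\<psi>. partial_orientation E \<psi> \<and> (\<forall>p<k. gain E \<psi> (Cs ! p) = y ! p)} \<subseteq> ?L"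
        using lab gains by blast
      show "?L \<subseteq> labeling ` {\<psi>. partial_orientation E \<psi> \<and> (\<forall>p<k. gain E \<psi> (Cs ! p) = y ! p)}"
      proof
        fix f assume f: "f \<in> ?L"
        then obtain \<psi> where "partial_orientation E \<psi>" "f = labeling \<psi>"
          using bij_betw_imp_surj_on[OF bij] by blast
        then show "f \<in> labeling ` {\<psi>. partial_orientation E \<psi> \<and> (\<forall>p<k. gain E \<psi> (Cs ! p) = y ! p)}"
          using f gains by blast
      qed
    qed
  qed auto
  then have "card {\<psi>. partial_orientation E \<psi> \<and> (\<forall>p<k. gain E \<psi> (Cs ! p) = y ! p)} = card ?L"
    by (rule bij_betw_same_card)
  also have "?L = (\<Union>X\<in>Gamma_set Cs y. {f \<in> E \<rightarrow>\<^sub>E ?B. face_matrix f = X})" by blast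
  also have "card \<dots> = (\<Sum>X\<in>Gamma_set Cs y. card {f \<in> E \<rightarrow>\<^sub>E ?B. face_matrix f = X})"
  proof (rule card_UN_disjoint[OF finite_Gamma_set])
    have "finite (E \<rightarrow>\<^sub>E ?B)" by (intro finite_PiE) auto
    then show "\<forall>X\<in>Gamma_set Cs y. finite {f \<in> E \<rightarrow>\<^sub>E ?B. face_matrix f = X}" by simp
  qed auto
  also have "\<dots> = (\<Sum>X\<in>Gamma_set Cs y. \<Prod>(p, q)\<in>blocks. alpha (X $$ (p, q)) (num_shared Cs p q))"
  proof (rule sum.cong[OF refl])
    fix X assume X: "X \<in> Gamma_set Cs y"
    have "card {f \<in> E \<rightarrow>\<^sub>E ?B. face_matrix f = X} =
      card {f \<in> (\<Union>i\<in>blocks. block i) \<rightarrow>\<^sub>E ?B. \<forall>i\<in>blocks. prod f (block i) = X $$ i}"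
      by (simp add: face_matrix_eq_iff[OF X] flip: edges_partition)
    also have "\<dots> = (\<Prod>i\<in>blocks. card {f \<in> block i \<rightarrow>\<^sub>E ?B. prod f (block i) = X $$ i})"
      by (rule card_labelings_of_disjoint_blocks[OF finite_blocks blocks_disjoint])
    also have "\<dots> = (\<Prod>i\<in>blocks. alpha (X $$ i) (card (block i)))"
      by (intro prod.cong refl card_labelings_alpha) simp
    also have "\<dots> = (\<Prod>(p, q)\<in>blocks. alpha (X $$ (p, q)) (num_shared Cs p q))"
      by (rule prod.cong) (auto simp: num_shared_def)
    finally show "card {f \<in> E \<rightarrow>\<^sub>E ?B. face_matrix f = X} =
      (\<Prod>(p, q)\<in>blocks. alpha (X $$ (p, q)) (num_shared Cs p q))" .
  qed
  finally show ?thesis .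
qed

end

theorem theorem4p8:
  fixes E :: "'v::finite set set"
    and pos :: "'v \<Rightarrow> complex"
    and crv :: "'v set \<Rightarrow> real \<Rightarrow> complex"
    and \<phi> :: "('v \<times> 'v) set"
    and Cs :: "'v list list"
  assumes "simple_graph E"
    and "plane_embedding E pos crv"
    and "two_connected E"
    and "partial_orientation E \<phi>"
    and "clockwise_face_cycles E pos crv Cs"
  shows "card (switching_class E \<phi>) =
    (\<Sum>X\<in>Gamma_set Cs (map (gain E \<phi>) Cs).
       \<Prod>(p, q) | p \<le> q \<and> q < length Cs \<and> num_shared Cs p q \<noteq> 0.
         alpha (X $$ (p, q)) (num_shared Cs p q))"
proof -
  interpret plane_graph E pos crv by standard (rule assms(1,2))+
  have face: "face_cycle E pos crv c" "clockwise pos crv c" if "c \<in> set Cs" for c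
    using assms(5) that by (auto simp: clockwise_face_cycles_def)
  interpret directed_cycle_cover E Cs
  proof
    show "simple_graph E" by (rule assms(1))
    show "is_cycle E c" if "c \<in> set Cs" for c using face(1)[OF that] by (simp add: face_cycle_def)
    show "\<exists>c\<in>set Cs. e \<in> cycle_edges c" if "e \<in> E" for e
      by (rule edge_on_face_cycle[OF assms(3,5) that])
    fix p q assume pq: "p < length Cs" "q < length Cs" "p \<noteq> q"
    have "distinct (map cycle_edges Cs)" using assms(5) by (simp add: clockwise_face_cycles_def)
    then have "map cycle_edges Cs ! p \<noteq> map cycle_edges Cs ! q"
      using pq by (simp add: nth_eq_iff_index_eq del: nth_map)
    then show "set (arrows (Cs ! p)) \<inter> set (arrows (Cs ! q)) = {}"
      using pq face by (intro clockwise_face_cycles_arrows_disjoint[OF assms(3)]) auto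
  qed
  have "switching_class E \<phi> =
    {\<psi>. partial_orientation E \<psi> \<and> (\<forall>p<length Cs. gain E \<psi> (Cs ! p) = map (gain E \<phi>) Cs ! p)}"
    unfolding switching_class_gains[OF assms(3,5,4)] by (auto simp: all_set_conv_all_nth)
  then show ?thesis using card_orientations_with_gains[of "map (gain E \<phi>) Cs"] by (simp add: blocks_def)
qed

end
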